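(* Let $(\mathcal G_1,e_1)$, $(\mathcal G_2,e_2)$ be rooted graphs with spectral distributions $\mu_1,\mu_2$, let their star loop product $\mathcal G_1\star_\ell\mathcal G_2$ (with root $e$) be naturally colored, and let $A(\mathcal G_1\star_\ell\mathcal G_2)=R_1+R_2$ be the decomposition of its adjacency matrix induced by the coloring. Put $Z=R_2R_1$. Then for every $n\in\mathbb N$ $$N_Z(n)=N_{\mu_1\circledast\mu_2}(n)=|D_{2n}(e)|,$$ where $N_Z(n)$ refers to the state $\varphi_e$, $\circledast$ is the boolean multiplicative convolution, and $D_{2n}(e)$ is the set of rooted alternating d-walks of length $2n$ on $\mathcal G_1\star_\ell\mathcal G_2$. Moreover, the pair $(R_1-1,R_2-1)$ is boolean independent with respect to $\varphi_e$.
   Context: Graphs are non-oriented, connected, uniformly locally finite (bounded degrees), with a root, possibly with loops and multiple edges. The adjacency matrix of $\mathcal G$ is the operator $A(\mathcal G)\delta(x)=\sum_{x'\sim x}n(x,x')\delta(x')$ on $\ell^2(V)$, $n(x,x')$ being the number of edges joining $x,x'$ (a loop at $x$ contributes $1$ to $n(x,x)$). $\varphi_e(\cdot)=\langle\cdot\,\delta(e),\delta(e)\rangle$; the spectral distribution of $(\mathcal G,e)$ is the distribution of $A(\mathcal G)$ in the state $\varphi_e$. Star product $\mathcal G_1\star\mathcal G_2$: glue $\mathcal G_1$ and $\mathcal G_2$ at their roots, the common root being the root $e$. Natural coloring: edges of $\mathcal G_\iota$ get color $\iota\in\{1,2\}$. Star loop product $\mathcal G_1\star_\ell\mathcal G_2$: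 obtained from the naturally colored star product by adding a loop of color $\iota$ to every vertex but the root of $\mathcal G_{\bar\iota}$, for each $\iota\in\{1,2\}$ ($\bar1=2,\bar2=1$). $R_\iota$ is the adjacency matrix of the subgraph of edges of color $\iota$. A walk from $v_0$ to $v_n$ is a sequence $(v_0,\beta_1,v_1,\dots,\beta_n,v_n)$, $\beta_i$ an edge joining $v_{i-1}$ and $v_i$; its length is $n$. An f-walk from $v$ to $v$ is a walk with $v_0=v_n=v$ and $v_i\neq v$ for $1\le i\le n-1$. A walk is alternating if the colors of its successive edges alternate. An alternating d-walk from $v$ to $v$ is an alternating walk beginning with an edge of color $1$ which is the concatenation $(u_1,u_2)$ of two f-walks from $v$ to $v$. Rooted means $v=e$. For a unital functional $\mu$ on $\mathbb C[X]$ ($\mu(1)=1$; compactly supported measures are identified with their moment functionals) put $\psi_\mu(z)=\sum_{n\ge1}\mu(X^n)z^n$, $\eta_\mu=\psi_\mu/(1+\psi_\mu)=\sum_{n\ge1}N_\mu(n)z^n$ (formal power series; $\eta_\mu$ determines $\mu$), $\rho_\mu(z)=\eta_\mu(z)/z$. For a random variable $Z$ and a state, $N_Z(n)=N_\mu(n)$ with $\mu$ the distribution of $Z$ in that state. Boolean multiplicative convolution: $\rho_{\mu_1\circledast\mu_2}(z)=\rho_{\mu_1}(z)\rho_{\mu_2}(z)$. A pair $(a,b)$ is boolean independent w.r.t. $\varphi$ if $\varphi(c_1c_2\cdots c_n)=\varphi(c_1)\cdots\varphi(c_n)$ whenever the $c_i$ are taken alternately from the non-unital algebras generated by $a$ and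 by $b$. *)

theory Defs
  imports "HOL-Analysis.Analysis" "HOL-Library.Uprod"
begin

section \<open>Rooted multigraphs and walks\<close>

text \<open>
  Edges carry their own identity, so that walks through parallel edges are distinguished;
  a loop at \<open>x\<close> is an edge \<open>\<beta>\<close> with \<open>ends G \<beta> = Upair x x\<close>.
\<close>

record ('v, 'e) multigraph =
  verts :: "'v set"
  edges :: "'e set"
  ends :: "'e \<Rightarrow> 'v uprod"

definition incident_edges :: "('v, 'e) multigraph \<Rightarrow> 'v \<Rightarrow> 'e set" where
  "incident_edges G x = {\<beta> \<in> edges G. x \<in> set_uprod (ends G \<beta>)}"

definition uniformly_locally_finite :: "('v, 'e) multigraph \<Rightarrow> bool" where
  "uniformly_locally_finite G \<longleftrightarrow>
     (\<exists>d. \<forall>x\<in>verts G. finite (incident_edges G x) \<and> card (incident_edges G x) \<le> d)"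

definition wf_multigraph :: "('v, 'e) multigraph \<Rightarrow> bool" where
  "wf_multigraph G \<longleftrightarrow> (\<forall>\<beta>\<in>edges G. set_uprod (ends G \<beta>) \<subseteq> verts G)"

text \<open>
  The walk \<open>(v\<^sub>0, \<beta>\<^sub>1, v\<^sub>1, \<dots>, \<beta>\<^sub>n, v\<^sub>n)\<close> is represented by the pair
  \<open>([v\<^sub>0, \<dots>, v\<^sub>n], [\<beta>\<^sub>1, \<dots>, \<beta>\<^sub>n])\<close>.
\<close>

type_synonym ('v, 'e) walk = "'v list \<times> 'e list"

definition is_walk :: "('v, 'e) multigraph \<Rightarrow> ('v, 'e) walk \<Rightarrow> bool" where
  "is_walk G w \<longleftrightarrow> (case w of (vs, es) \<Rightarrow>
     length vs = Suc (length es) \<and> set vs \<subseteq> verts G \<and> set es \<subseteq> edges G \<and>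
     (\<forall>i < length es. ends G (es ! i) = Upair (vs ! i) (vs ! Suc i)))"

definition walk_length :: "('v, 'e) walk \<Rightarrow> nat" where
  "walk_length w = length (snd w)"

definition is_walk_between :: "('v, 'e) multigraph \<Rightarrow> 'v \<Rightarrow> ('v, 'e) walk \<Rightarrow> 'v \<Rightarrow> bool" where
  "is_walk_between G x w y \<longleftrightarrow> is_walk G w \<and> hd (fst w) = x \<and> last (fst w) = y"

definition connected_multigraph :: "('v, 'e) multigraph \<Rightarrow> bool" where
  "connected_multigraph G \<longleftrightarrow> (\<forall>x\<in>verts G. \<forall>y\<in>verts G. \<exists>w. is_walk_between G x w y)"

definition rooted_graph :: "('v, 'e) multigraph \<Rightarrow> 'v \<Rightarrow> bool" where
  "rooted_graph G e \<longleftrightarrow>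
     wf_multigraph G \<and> connected_multigraph G \<and> uniformly_locally_finite G \<and> e \<in> verts G"

definition walk_concat :: "('v, 'e) walk \<Rightarrow> ('v, 'e) walk \<Rightarrow> ('v, 'e) walk" where
  "walk_concat u w = (fst u @ tl (fst w), snd u @ snd w)"

text \<open>An f-walk returns to its starting point for the first time at its end; it has positive length.\<close>

definition is_f_walk :: "('v, 'e) multigraph \<Rightarrow> 'v \<Rightarrow> ('v, 'e) walk \<Rightarrow> bool" where
  "is_f_walk G v w \<longleftrightarrow> is_walk_between G v w v \<and> walk_length w \<ge> 1 \<and>
     (\<forall>i. 1 \<le> i \<and> i < walk_length w \<longrightarrow> fst w ! i \<noteq> v)"

datatype color = Color1 | Color2

definition is_alternating :: "('e \<Rightarrow> color) \<Rightarrow> ('v, 'e) walk \<Rightarrow> bool" where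
  "is_alternating col w \<longleftrightarrow>
     (\<forall>i. Suc i < walk_length w \<longrightarrow> col (snd w ! i) \<noteq> col (snd w ! Suc i))"

definition is_alternating_d_walk ::
    "('v, 'e) multigraph \<Rightarrow> ('e \<Rightarrow> color) \<Rightarrow> 'v \<Rightarrow> ('v, 'e) walk \<Rightarrow> bool" where
  "is_alternating_d_walk G col v w \<longleftrightarrow>
     is_alternating col w \<and> snd w \<noteq> [] \<and> col (hd (snd w)) = Color1 \<and>
     (\<exists>u1 u2. is_f_walk G v u1 \<and> is_f_walk G v u2 \<and> w = walk_concat u1 u2)"

definition alternating_d_walks ::
    "('v, 'e) multigraph \<Rightarrow> ('e \<Rightarrow> color) \<Rightarrow> 'v \<Rightarrow> nat \<Rightarrow> ('v, 'e) walk set" where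
  "alternating_d_walks G col v n = {w. is_alternating_d_walk G col v w \<and> walk_length w = n}"


section \<open>Star product and star loop product\<close>

text \<open>
  Gluing at the roots is realised inside the product: \<open>x \<in> V\<^sub>1\<close> becomes \<open>(x, e\<^sub>2)\<close>,
  \<open>y \<in> V\<^sub>2\<close> becomes \<open>(e\<^sub>1, y)\<close>, and the common root is \<open>(e\<^sub>1, e\<^sub>2)\<close>.
\<close>

definition star_product ::
    "('a, 'c) multigraph \<Rightarrow> 'a \<Rightarrow> ('b, 'd) multigraph \<Rightarrow> 'b \<Rightarrow> ('a \<times> 'b, 'c + 'd) multigraph" where
  "star_product G1 e1 G2 e2 =
     \<lparr> verts = (\<lambda>x. (x, e2)) ` verts G1 \<union> (\<lambda>y. (e1, y)) ` verts G2,
       edges = edges G1 <+> edges G2,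
       ends = case_sum (\<lambda>\<beta>. map_uprod (\<lambda>x. (x, e2)) (ends G1 \<beta>))
                       (\<lambda>\<beta>. map_uprod (\<lambda>y. (e1, y)) (ends G2 \<beta>)) \<rparr>"

definition star_coloring :: "'c + 'd \<Rightarrow> color" where
  "star_coloring = case_sum (\<lambda>_. Color1) (\<lambda>_. Color2)"

text \<open>
  The added loops are the edges \<open>Inr (\<iota>, v)\<close>, of color \<open>\<iota>\<close> and based at \<open>v\<close>. Loops of color 1
  are put on the non-root vertices of the second graph and vice versa; the common root gets none.
\<close>

definition star_loop_product ::
    "('a, 'c) multigraph \<Rightarrow> 'a \<Rightarrow> ('b, 'd) multigraph \<Rightarrow> 'b \<Rightarrow>
     ('a \<times> 'b, ('c + 'd) + (color \<times> ('a \<times> 'b))) multigraph" where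
  "star_loop_product G1 e1 G2 e2 =
     \<lparr> verts = verts (star_product G1 e1 G2 e2),
       edges = edges (star_product G1 e1 G2 e2) <+>
         ({Color1} \<times> ((\<lambda>y. (e1, y)) ` (verts G2 - {e2})) \<union>
          {Color2} \<times> ((\<lambda>x. (x, e2)) ` (verts G1 - {e1}))),
       ends = case_sum (ends (star_product G1 e1 G2 e2)) (\<lambda>(_, v). Upair v v) \<rparr>"

definition natural_coloring :: "('c + 'd) + (color \<times> 'v) \<Rightarrow> color" where
  "natural_coloring = case_sum star_coloring fst"

definition color_subgraph ::
    "('v, 'e) multigraph \<Rightarrow> ('e \<Rightarrow> color) \<Rightarrow> color \<Rightarrow> ('v, 'e) multigraph" where
  "color_subgraph G col c = G\<lparr> edges := {\<beta> \<in> edges G. col \<beta> = c} \<rparr>"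


section \<open>Adjacency operators\<close>

text \<open>
  \<open>\<ell>\<^sup>2(V)\<close> is the set of square-summable functions vanishing outside \<open>V\<close>. Operators on it are
  represented by maps on functions; products of operators are compositions, and the unit is \<open>id\<close>.
\<close>

type_synonym 'v operator = "('v \<Rightarrow> complex) \<Rightarrow> ('v \<Rightarrow> complex)"

definition l2 :: "'v set \<Rightarrow> ('v \<Rightarrow> complex) set" where
  "l2 V = {f. (\<forall>x. x \<notin> V \<longrightarrow> f x = 0) \<and> (\<lambda>x. (cmod (f x))\<^sup>2) summable_on UNIV}"

definition l2_inner :: "('v \<Rightarrow> complex) \<Rightarrow> ('v \<Rightarrow> complex) \<Rightarrow> complex" where
  "l2_inner f g = (\<Sum>\<^sub>\<infinity>x. f x * cnj (g x))"

definition delta :: "'v \<Rightarrow> 'v \<Rightarrow> complex" where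
  "delta x = (\<lambda>y. if y = x then 1 else 0)"

definition vector_state :: "'v \<Rightarrow> 'v operator \<Rightarrow> complex" where
  "vector_state e T = l2_inner (T (delta e)) (delta e)"

definition neighbours :: "('v, 'e) multigraph \<Rightarrow> 'v \<Rightarrow> 'v set" where
  "neighbours G x = {y. \<exists>\<beta>\<in>edges G. ends G \<beta> = Upair x y}"

definition edge_count :: "('v, 'e) multigraph \<Rightarrow> 'v \<Rightarrow> 'v \<Rightarrow> nat" where
  "edge_count G x y = card {\<beta> \<in> edges G. ends G \<beta> = Upair x y}"

text \<open>
  As the matrix \<open>edge_count G\<close> is symmetric, this is the operator with
  \<open>A \<delta>(x) = \<Sum>\<^bsub>y \<sim> x\<^esub> n(x, y) \<delta>(y)\<close>; it maps \<open>\<ell>\<^sup>2(V)\<close> boundedly into itself. Both facts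
  are proved below.
\<close>

definition adjacency_operator :: "('v, 'e) multigraph \<Rightarrow> 'v operator" where
  "adjacency_operator G f = (\<lambda>x. \<Sum>y\<in>neighbours G x. of_nat (edge_count G x y) * f y)"


section \<open>Moment functionals\<close>

text \<open>
  A functional on \<open>\<complex>[X]\<close> is a map \<open>complex poly \<Rightarrow> complex\<close>; compactly supported measures are
  identified with their moment functionals.
\<close>

definition unital_functional :: "(complex poly \<Rightarrow> complex) \<Rightarrow> bool" where
  "unital_functional \<mu> \<longleftrightarrow>
     (\<forall>p q. \<mu> (p + q) = \<mu> p + \<mu> q) \<and> (\<forall>c p. \<mu> (smult c p) = c * \<mu> p) \<and> \<mu> 1 = 1"

definition poly_operator :: "complex poly \<Rightarrow> 'v operator \<Rightarrow> 'v operator" where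
  "poly_operator p T = (\<lambda>f x. \<Sum>i\<le>degree p. coeff p i * (T ^^ i) f x)"

definition distribution_of :: "('v operator \<Rightarrow> complex) \<Rightarrow> 'v operator \<Rightarrow> complex poly \<Rightarrow> complex" where
  "distribution_of \<phi> T = (\<lambda>p. \<phi> (poly_operator p T))"

definition spectral_distribution :: "('v, 'e) multigraph \<Rightarrow> 'v \<Rightarrow> complex poly \<Rightarrow> complex" where
  "spectral_distribution G e = distribution_of (vector_state e) (adjacency_operator G)"

definition psi :: "(complex poly \<Rightarrow> complex) \<Rightarrow> complex fps" where
  "psi \<mu> = Abs_fps (\<lambda>n. if n = 0 then 0 else \<mu> (monom 1 n))"

definition eta :: "(complex poly \<Rightarrow> complex) \<Rightarrow> complex fps" where
  "eta \<mu> = psi \<mu> / (1 + psi \<mu>)"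

definition eta_coeff :: "(complex poly \<Rightarrow> complex) \<Rightarrow> nat \<Rightarrow> complex" where
  "eta_coeff \<mu> n = fps_nth (eta \<mu>) n"

definition rho :: "(complex poly \<Rightarrow> complex) \<Rightarrow> complex fps" where
  "rho \<mu> = eta \<mu> / fps_X"

text \<open>Existence and uniqueness of the functional described here are proved below.\<close>

definition boolean_mult_conv ::
    "(complex poly \<Rightarrow> complex) \<Rightarrow> (complex poly \<Rightarrow> complex) \<Rightarrow> complex poly \<Rightarrow> complex" where
  "boolean_mult_conv \<mu>1 \<mu>2 = (THE \<mu>. unital_functional \<mu> \<and> rho \<mu> = rho \<mu>1 * rho \<mu>2)"


section \<open>Boolean independence\<close>

inductive_set nonunital_algebra :: "'v operator \<Rightarrow> 'v operator set" for a :: "'v operator" where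
  generator: "a \<in> nonunital_algebra a"
| add: "S \<in> nonunital_algebra a \<Longrightarrow> T \<in> nonunital_algebra a \<Longrightarrow>
          (\<lambda>f x. S f x + T f x) \<in> nonunital_algebra a"
| scale: "T \<in> nonunital_algebra a \<Longrightarrow> (\<lambda>f x. c * T f x) \<in> nonunital_algebra a"
| mult: "S \<in> nonunital_algebra a \<Longrightarrow> T \<in> nonunital_algebra a \<Longrightarrow> S \<circ> T \<in> nonunital_algebra a"

definition boolean_independent :: "('v operator \<Rightarrow> complex) \<Rightarrow> 'v operator \<Rightarrow> 'v operator \<Rightarrow> bool" where
  "boolean_independent \<phi> a b \<longleftrightarrow>
     (\<forall>cs. cs \<noteq> [] \<and>
        ((\<forall>i < length cs. cs ! i \<in> nonunital_algebra (if even i then a else b)) \<or>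
         (\<forall>i < length cs. cs ! i \<in> nonunital_algebra (if even i then b else a))) \<longrightarrow>
        \<phi> (foldr (\<circ>) cs id) = prod_list (map \<phi> cs))"


section \<open>Consistency of the definitions\<close>

lemma edge_count_commute: "edge_count G x y = edge_count G y x"
proof -
  have "Upair x y = Upair y x" by simp
  then show ?thesis unfolding edge_count_def by presburger
qed

lemma neighbours_commute: "y \<in> neighbours G x \<longleftrightarrow> x \<in> neighbours G y"
proof -
  have "Upair x y = Upair y x" by simp
  then show ?thesis unfolding neighbours_def mem_Collect_eq by presburger
qed

lemma incident_edges_finite:
  assumes "wf_multigraph G" "uniformly_locally_finite G"
  shows "finite (incident_edges G x)"
proof (cases "x \<in> verts G")
  case True
  then show ?thesis using assms(2) by (auto simp: uniformly_locally_finite_def)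
next
  case False
  then have "incident_edges G x = {}"
    using assms(1) by (auto simp: incident_edges_def wf_multigraph_def)
  then show ?thesis by simp
qed

lemma neighbours_finite:
  assumes "wf_multigraph G" "uniformly_locally_finite G"
  shows "finite (neighbours G x)"
proof -
  have "neighbours G x \<subseteq> (\<Union>\<beta>\<in>incident_edges G x. set_uprod (ends G \<beta>))"
  proof
    fix y assume "y \<in> neighbours G x"
    then obtain \<beta> where "\<beta> \<in> edges G" "ends G \<beta> = Upair x y" by (auto simp: neighbours_def)
    then show "y \<in> (\<Union>\<beta>\<in>incident_edges G x. set_uprod (ends G \<beta>))"
      by (auto simp: incident_edges_def intro!: bexI[of _ \<beta>])
  qed
  then show ?thesis using incident_edges_finite[OF assms] by (auto intro: finite_subset)
qed

lemma edge_count_sum_le: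
  assumes "wf_multigraph G" "uniformly_locally_finite G" "finite Y"
  shows "(\<Sum>y\<in>Y. edge_count G x y) \<le> card (incident_edges G x)"
proof -
  define B where "B y = {\<beta> \<in> edges G. ends G \<beta> = Upair x y}" for y
  have sub: "B y \<subseteq> incident_edges G x" for y by (auto simp: B_def incident_edges_def)
  have fin: "finite (incident_edges G x)" by (rule incident_edges_finite[OF assms(1,2)])
  have "(\<Sum>y\<in>Y. edge_count G x y) = card (\<Union>y\<in>Y. B y)"
    unfolding edge_count_def B_def[symmetric]
    by (rule card_UN_disjoint[symmetric])
       (use assms(3) finite_subset[OF sub fin] in \<open>auto simp: B_def\<close>)
  also have "\<dots> \<le> card (incident_edges G x)"
    by (rule card_mono[OF fin]) (use sub in auto)
  finally show ?thesis .
qed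

lemma adjacency_operator_delta:
  assumes "wf_multigraph G" "uniformly_locally_finite G"
  shows "adjacency_operator G (delta x) =
    (\<lambda>z. \<Sum>y\<in>neighbours G x. of_nat (edge_count G x y) * delta y z)"
proof
  fix z
  have "adjacency_operator G (delta x) z =
      (if x \<in> neighbours G z then of_nat (edge_count G z x) else 0)"
    unfolding adjacency_operator_def delta_def
    by (simp add: neighbours_finite[OF assms] if_distrib[of "(*) _"] sum.delta cong: if_cong)
  also have "\<dots> = (\<Sum>y\<in>neighbours G x. of_nat (edge_count G x y) * delta y z)"
    unfolding delta_def
    by (simp add: neighbours_finite[OF assms] if_distrib[of "(*) _"] sum.delta'
        neighbours_commute[of z] edge_count_commute[of G z] cong: if_cong)
  finally show "adjacency_operator G (delta x) z = \<dots>" .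
qed

lemma adjacency_operator_bounded:
  assumes "wf_multigraph G" "uniformly_locally_finite G"
  obtains C where "\<And>f. f \<in> l2 (verts G) \<Longrightarrow> adjacency_operator G f \<in> l2 (verts G) \<and>
    (\<Sum>\<^sub>\<infinity>x. (cmod (adjacency_operator G f x))\<^sup>2) \<le> C * (\<Sum>\<^sub>\<infinity>x. (cmod (f x))\<^sup>2)"
proof -
  let ?A = "adjacency_operator G" and ?N = "neighbours G" and ?n = "\<lambda>x y. real (edge_count G x y)"
  obtain d0 where d0: "card (incident_edges G x) \<le> d0" if "x \<in> verts G" for x
    using assms(2) unfolding uniformly_locally_finite_def by metis
  define d where "d = real d0"
  have d_nonneg: "d \<ge> 0" by (simp add: d_def)
  have out: "?N x = {}" "incident_edges G x = {}" if "x \<notin> verts G" for x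
    using assms(1) that by (auto simp: neighbours_def incident_edges_def wf_multigraph_def)
  have n_le: "(\<Sum>y\<in>Y. ?n x y) \<le> d" if "finite Y" for x Y
  proof -
    have "card (incident_edges G x) \<le> d0" using d0 out(2)[of x] by (cases "x \<in> verts G") auto
    then have "(\<Sum>y\<in>Y. edge_count G x y) \<le> d0"
      using edge_count_sum_le[OF assms that, of x] by linarith
    then show ?thesis by (simp add: d_def flip: of_nat_sum)
  qed
  have pointwise: "(cmod (?A f x))\<^sup>2 \<le> d * (\<Sum>y\<in>?N x. ?n x y * (cmod (f y))\<^sup>2)" for f x
  proof -
    have "cmod (?A f x) \<le> (\<Sum>y\<in>?N x. ?n x y * cmod (f y))"
      unfolding adjacency_operator_def by (rule order_trans[OF norm_sum]) (simp add: norm_mult)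
    then have "(cmod (?A f x))\<^sup>2 \<le> (\<Sum>y\<in>?N x. ?n x y * cmod (f y))\<^sup>2"
      by (simp add: power_mono)
    also have "\<dots> = (\<Sum>y\<in>?N x. sqrt (?n x y) * (sqrt (?n x y) * cmod (f y)))\<^sup>2"
      by (simp flip: mult.assoc)
    also have "\<dots> \<le> (\<Sum>y\<in>?N x. (sqrt (?n x y))\<^sup>2) * (\<Sum>y\<in>?N x. (sqrt (?n x y) * cmod (f y))\<^sup>2)"
      by (rule Cauchy_Schwarz_ineq_sum)
    also have "\<dots> = (\<Sum>y\<in>?N x. ?n x y) * (\<Sum>y\<in>?N x. ?n x y * (cmod (f y))\<^sup>2)"
      by (simp add: power_mult_distrib)
    also have "\<dots> \<le> d * (\<Sum>y\<in>?N x. ?n x y * (cmod (f y))\<^sup>2)"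
      by (rule mult_right_mono[OF n_le[OF neighbours_finite[OF assms]]]) (simp add: sum_nonneg)
    finally show ?thesis .
  qed
  have finite_bound: "(\<Sum>x\<in>F. (cmod (?A f x))\<^sup>2) \<le> d\<^sup>2 * (\<Sum>\<^sub>\<infinity>x. (cmod (f x))\<^sup>2)"
    if f: "f \<in> l2 (verts G)" and F: "finite F" for f F
  proof -
    define Y where "Y = (\<Union>x\<in>F. ?N x)"
    have Y: "finite Y" using F neighbours_finite[OF assms] by (simp add: Y_def)
    have summable: "(\<lambda>x. (cmod (f x))\<^sup>2) summable_on UNIV" using f by (simp add: l2_def)
    have "(\<Sum>x\<in>F. (cmod (?A f x))\<^sup>2) \<le> (\<Sum>x\<in>F. d * (\<Sum>y\<in>?N x. ?n x y * (cmod (f y))\<^sup>2))"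
      by (rule sum_mono) (rule pointwise)
    also have "\<dots> \<le> (\<Sum>x\<in>F. d * (\<Sum>y\<in>Y. ?n x y * (cmod (f y))\<^sup>2))"
      by (intro sum_mono mult_left_mono sum_mono2 Y d_nonneg) (auto simp: Y_def)
    also have "\<dots> = d * (\<Sum>y\<in>Y. (\<Sum>x\<in>F. ?n y x) * (cmod (f y))\<^sup>2)"
      by (simp add: sum.swap[of _ Y F] edge_count_commute[of G] flip: sum_distrib_left sum_distrib_right)
    also have "\<dots> \<le> d * (\<Sum>y\<in>Y. d * (cmod (f y))\<^sup>2)"
      by (intro mult_left_mono sum_mono mult_right_mono n_le F d_nonneg) simp
    also have "\<dots> = d\<^sup>2 * (\<Sum>y\<in>Y. (cmod (f y))\<^sup>2)"
      by (simp add: sum_distrib_left power2_eq_square mult.assoc)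
    also have "\<dots> \<le> d\<^sup>2 * (\<Sum>\<^sub>\<infinity>x. (cmod (f x))\<^sup>2)"
      by (intro mult_left_mono finite_sum_le_infsum summable Y) auto
    finally show ?thesis .
  qed
  have "?A f \<in> l2 (verts G) \<and> (\<Sum>\<^sub>\<infinity>x. (cmod (?A f x))\<^sup>2) \<le> d\<^sup>2 * (\<Sum>\<^sub>\<infinity>x. (cmod (f x))\<^sup>2)"
    if f: "f \<in> l2 (verts G)" for f
  proof -
    have "(\<lambda>x. (cmod (?A f x))\<^sup>2) summable_on UNIV"
      by (rule nonneg_bdd_above_summable_on)
         (use finite_bound[OF f] in \<open>auto intro!: bdd_aboveI\<close>)
    moreover have "?A f x = 0" if "x \<notin> verts G" for x
      using out(1)[OF that] by (simp add: adjacency_operator_def)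
    ultimately show ?thesis
      using finite_bound[OF f] by (auto simp: l2_def intro: infsum_le_finite_sums)
  qed
  then show thesis by (rule that)
qed

lemma adjacency_operator_color_decomposition:
  assumes "wf_multigraph G" "uniformly_locally_finite G"
  shows "adjacency_operator G f x =
    adjacency_operator (color_subgraph G col Color1) f x +
    adjacency_operator (color_subgraph G col Color2) f x"
proof -
  let ?G = "color_subgraph G col"
  have ext: "adjacency_operator (?G c) f x =
      (\<Sum>y\<in>neighbours G x. of_nat (edge_count (?G c) x y) * f y)" for c
    unfolding adjacency_operator_def
  proof (rule sum.mono_neutral_left[OF neighbours_finite[OF assms]])
    show "neighbours (?G c) x \<subseteq> neighbours G x"
      by (auto simp: neighbours_def color_subgraph_def)
    show "\<forall>y\<in>neighbours G x - neighbours (?G c) x. of_nat (edge_count (?G c) x y) * f y = 0"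
    proof
      fix y assume "y \<in> neighbours G x - neighbours (?G c) x"
      then have "{\<beta> \<in> edges (?G c). ends (?G c) \<beta> = Upair x y} = {}"
        by (auto simp: neighbours_def)
      then show "of_nat (edge_count (?G c) x y) * f y = 0"
        by (simp only: edge_count_def card.empty) simp
    qed
  qed
  have count: "edge_count G x y = edge_count (?G Color1) x y + edge_count (?G Color2) x y" for y
  proof -
    let ?B = "\<lambda>c. {\<beta> \<in> edges (?G c). ends (?G c) \<beta> = Upair x y}"
    have "?B c \<subseteq> incident_edges G x" for c by (auto simp: incident_edges_def color_subgraph_def)
    then have fin: "finite (?B c)" for c
      using incident_edges_finite[OF assms] finite_subset by blast
    have "{\<beta> \<in> edges G. ends G \<beta> = Upair x y} = ?B Color1 \<union> ?B Color2"
    proof -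
      have "col \<beta> = Color1 \<or> col \<beta> = Color2" for \<beta> by (cases "col \<beta>") simp_all
      then show ?thesis by (auto simp: color_subgraph_def)
    qed
    moreover have "?B Color1 \<inter> ?B Color2 = {}" by (auto simp: color_subgraph_def)
    ultimately show ?thesis unfolding edge_count_def
      by (simp only: card_Un_disjoint[OF fin fin])
  qed
  show ?thesis
    unfolding ext unfolding adjacency_operator_def count
    by (simp add: distrib_right sum.distrib)
qed

lemma star_loop_product_wf:
  assumes "wf_multigraph G1" "wf_multigraph G2"
  shows "wf_multigraph (star_loop_product G1 e1 G2 e2)"
proof -
  have set_map: "set_uprod (map_uprod h u) = h ` set_uprod u" for h :: "'x \<Rightarrow> 'y" and u
    by (cases u) auto
  show ?thesis using assms
    by (fastforce simp: wf_multigraph_def star_loop_product_def star_product_def set_map)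
qed

lemma star_loop_product_uniformly_locally_finite:
  fixes G1 :: "('a, 'c) multigraph" and G2 :: "('b, 'd) multigraph"
  assumes "rooted_graph G1 e1" "rooted_graph G2 e2"
  shows "uniformly_locally_finite (star_loop_product G1 e1 G2 e2)"
proof -
  let ?H = "star_loop_product G1 e1 G2 e2"
  have set_map: "set_uprod (map_uprod h u) = h ` set_uprod u" for h :: "'x \<Rightarrow> 'y" and u
    by (cases u) auto
  obtain d1 where d1: "finite (incident_edges G1 x) \<and> card (incident_edges G1 x) \<le> d1"
    if "x \<in> verts G1" for x
    using assms(1) unfolding rooted_graph_def uniformly_locally_finite_def by blast
  obtain d2 where d2: "finite (incident_edges G2 y) \<and> card (incident_edges G2 y) \<le> d2"
    if "y \<in> verts G2" for y
    using assms(2) unfolding rooted_graph_def uniformly_locally_finite_def by blast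
  have "finite (incident_edges ?H v) \<and> card (incident_edges ?H v) \<le> d1 + d2 + 2"
    if v: "v \<in> verts ?H" for v
  proof -
    let ?B1 = "(\<lambda>\<beta>. Inl (Inl \<beta>) :: ('c + 'd) + (color \<times> ('a \<times> 'b))) ` incident_edges G1 (fst v)"
    let ?B2 = "(\<lambda>\<beta>. Inl (Inr \<beta>) :: ('c + 'd) + (color \<times> ('a \<times> 'b))) ` incident_edges G2 (snd v)"
    let ?L = "{Inr (Color1, v), Inr (Color2, v)} :: (('c + 'd) + (color \<times> ('a \<times> 'b))) set"
    have in_V: "fst v \<in> verts G1" "snd v \<in> verts G2"
      using v assms by (auto simp: star_loop_product_def star_product_def rooted_graph_def)
    have sub: "incident_edges ?H v \<subseteq> ?B1 \<union> ?B2 \<union> ?L"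
      by (auto simp: incident_edges_def star_loop_product_def star_product_def set_map)
    have fin: "finite (?B1 \<union> ?B2 \<union> ?L)" using d1[OF in_V(1)] d2[OF in_V(2)] by simp
    have "card ?B1 \<le> d1"
      using d1[OF in_V(1)] by (meson card_image_le order_trans)
    moreover have "card ?B2 \<le> d2"
      using d2[OF in_V(2)] by (meson card_image_le order_trans)
    moreover have "card ?L \<le> 2" by simp
    ultimately have "card (?B1 \<union> ?B2 \<union> ?L) \<le> d1 + d2 + 2"
      using card_Un_le[of "?B1 \<union> ?B2" ?L] card_Un_le[of ?B1 ?B2] by linarith
    then show ?thesis using sub fin by (meson card_mono finite_subset order_trans)
  qed
  then show ?thesis unfolding uniformly_locally_finite_def by blast
qed

lemma unital_functional_eqI:
  assumes "unital_functional \<mu>" "unital_functional \<nu>" "psi \<mu> = psi \<nu>"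
  shows "\<mu> = \<nu>"
proof
  fix p
  have "\<mu> (monom 1 n) = \<nu> (monom 1 n)" for n
  proof (cases "n = 0")
    case True
    then show ?thesis using assms(1,2) by (simp add: unital_functional_def)
  next
    case False
    then show ?thesis using assms(3) by (auto simp: psi_def fps_eq_iff split: if_splits)
  qed
  then have monoms: "\<mu> (monom c n) = \<nu> (monom c n)" for c n
  proof -
    have "monom c n = smult c (monom 1 n)" by (simp add: smult_monom)
    then show ?thesis using assms(1,2) \<open>\<mu> (monom 1 n) = \<nu> (monom 1 n)\<close>
      by (simp only: unital_functional_def)
  qed
  have zero: "\<mu> 0 = \<nu> 0" using monoms[of 0 0] by simp
  have "\<mu> (\<Sum>i\<in>I. monom (coeff p i) i) = \<nu> (\<Sum>i\<in>I. monom (coeff p i) i)" if "finite I" for I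
    using that
  proof (induction I)
    case empty
    show ?case using zero by simp
  next
    case (insert i I)
    have "\<mu> (x + y) = \<mu> x + \<mu> y" "\<nu> (x + y) = \<nu> x + \<nu> y" for x y
      using assms(1,2) by (simp_all only: unital_functional_def)
    then show ?case using insert monoms by simp
  qed
  from this[of "{..degree p}"] show "\<mu> p = \<nu> p" by (simp add: poly_as_sum_of_monoms)
qed

lemma psi_eta: "psi \<mu> = eta \<mu> / (1 - eta \<mu>)"
proof -
  have unit: "fps_nth (1 + psi \<mu>) 0 \<noteq> 0" by (simp add: psi_def)
  have eta: "eta \<mu> * (1 + psi \<mu>) = psi \<mu>"
    unfolding eta_def using unit by (simp add: fps_divide_unit mult.assoc inverse_mult_eq_1)
  have "fps_nth (eta \<mu>) 0 = 0"
    using arg_cong[OF eta, of "\<lambda>f. fps_nth f 0"] by (simp add: psi_def)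
  then have unit': "fps_nth (1 - eta \<mu>) 0 \<noteq> 0" by simp
  then have "1 - eta \<mu> \<noteq> 0" by force
  moreover have "psi \<mu> * (1 - eta \<mu>) = eta \<mu>" using eta by (simp add: algebra_simps)
  ultimately show ?thesis by (metis nonzero_mult_div_cancel_right)
qed

lemma eta_rho: "eta \<mu> = fps_X * rho \<mu>"
proof -
  have "fps_nth (eta \<mu>) 0 = 0"
    unfolding eta_def by (simp add: fps_divide_unit psi_def)
  then show ?thesis
    unfolding rho_def by (simp add: fps_eq_iff fps_X_mult_nth split: nat.split)
qed

lemma unital_functional_exists:
  fixes m :: "nat \<Rightarrow> complex"
  assumes "m 0 = 1"
  obtains \<mu> where "unital_functional \<mu>" "\<And>n. \<mu> (monom 1 n) = m n"
proof -
  define \<mu> where "\<mu> p = (\<Sum>i\<le>degree p. coeff p i * m i)" for p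
  have ext: "\<mu> p = (\<Sum>i\<le>N. coeff p i * m i)" if "degree p \<le> N" for p N
    unfolding \<mu>_def using that by (intro sum.mono_neutral_left) (auto simp: coeff_eq_0)
  have "\<mu> (p + q) = \<mu> p + \<mu> q" for p q
    using ext[of p "max (degree p) (degree q)"] ext[of q "max (degree p) (degree q)"]
      ext[of "p + q" "max (degree p) (degree q)"] degree_add_le_max[of p q]
    by (simp add: sum.distrib distrib_right)
  moreover have "\<mu> (smult c p) = c * \<mu> p" for c p
    using ext[of "smult c p" "degree p"] degree_smult_le[of c p]
    by (simp add: \<mu>_def sum_distrib_left mult.assoc)
  moreover have "\<mu> 1 = 1" using assms by (simp add: \<mu>_def)
  ultimately have "unital_functional \<mu>" by (simp add: unital_functional_def)
  moreover have mon: "\<mu> (monom 1 n) = m n" for n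
  proof -
    have "\<mu> (monom 1 n) = (\<Sum>i\<le>n. if i = n then m i else 0)"
      unfolding \<mu>_def by (intro sum.cong) (simp_all add: degree_monom_eq)
    then show ?thesis by simp
  qed
  ultimately show thesis by (rule that)
qed

lemma boolean_mult_conv_ex1: "\<exists>!\<mu>. unital_functional \<mu> \<and> rho \<mu> = rho \<mu>1 * rho \<mu>2"
proof (rule ex_ex1I)
  define h where "h = fps_X * (rho \<mu>1 * rho \<mu>2)"
  define g where "g = h / (1 - h)"
  have h0: "fps_nth h 0 = 0" by (simp add: h_def)
  then have unit: "fps_nth (1 - h) 0 \<noteq> 0" by simp
  have g: "g * (1 - h) = h"
    unfolding g_def using unit by (simp add: fps_divide_unit mult.assoc inverse_mult_eq_1)
  have g0: "fps_nth g 0 = 0" using arg_cong[OF g, of "\<lambda>f. fps_nth f 0"] h0 by simp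
  obtain \<mu> where \<mu>: "unital_functional \<mu>"
      "\<And>n. \<mu> (monom 1 n) = (if n = 0 then 1 else fps_nth g n)"
    using unital_functional_exists[of "\<lambda>n. if n = 0 then 1 else fps_nth g n"] by auto
  have psi: "psi \<mu> = g" using g0 by (auto simp: psi_def \<mu>(2) fps_eq_iff)
  have unit': "fps_nth (1 + g) 0 \<noteq> 0" using g0 by simp
  have "h * (1 + g) = g" using g by (simp add: algebra_simps)
  moreover have "1 + g \<noteq> 0" using unit' by force
  ultimately have "eta \<mu> = h"
    unfolding eta_def psi by (metis nonzero_mult_div_cancel_right)
  then have "rho \<mu> = rho \<mu>1 * rho \<mu>2" unfolding rho_def[of \<mu>] h_def
    by (simp add: fps_eq_iff)
  with \<mu>(1) show "\<exists>\<mu>. unital_functional \<mu> \<and> rho \<mu> = rho \<mu>1 * rho \<mu>2" by blast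
next
  fix \<mu> \<nu>
  assume "unital_functional \<mu> \<and> rho \<mu> = rho \<mu>1 * rho \<mu>2"
    and "unital_functional \<nu> \<and> rho \<nu> = rho \<mu>1 * rho \<mu>2"
  then show "\<mu> = \<nu>" by (intro unital_functional_eqI) (simp_all add: psi_eta eta_rho)
qed

end

theory Submission
  imports Defs
begin

text \<open>
  Call the value at the root of \<open>T (P T)\<^sup>k \<delta>\<^sub>e\<close>, where \<open>P\<close> kills the value at \<open>e\<close>, the
  first return coefficient of \<open>T\<close> at time \<open>k + 1\<close>; splitting \<open>T\<^sup>n \<delta>\<^sub>e\<close> at the first return
  to \<open>e\<close> shows that these are the coefficients of the \<open>\<eta>\<close>-series of \<open>T\<close>. In the star loop
  product, \<open>R\<^sub>\<iota>\<close> acts as the adjacency matrix of \<open>G\<^sub>\<iota>\<close> on functions supported on the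
  \<open>\<iota>\<close>-th graph and, thanks to the loops, as the identity on functions supported on the other
  graph that vanish at the root. Hence \<open>R\<^sub>\<iota> - 1\<close> maps into functions on the \<open>\<iota>\<close>-th graph and
  sees only the root value of functions on the other one, which gives boolean independence. The same two
  facts make the first return coefficients of \<open>R\<^sub>2 R\<^sub>1\<close> a convolution of those of \<open>R\<^sub>1\<close> and
  \<open>R\<^sub>2\<close>. Finally an alternating d-walk is counted by an alternating product of \<open>R\<^sub>1\<close>
  and \<open>R\<^sub>2\<close> with \<open>P\<close> inserted at all times but the middle return to \<open>e\<close>, and this product
  collapses to a product of two first return coefficients.
\<close>

section \<open>First return coefficients\<close>

lemma vector_state_eq: "vector_state e T = T (delta e) e"
proof -
  have "vector_state e T = (\<Sum>\<^sub>\<infinity>x\<in>{e}. T (delta e) x * cnj (delta e x))"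
    unfolding vector_state_def l2_inner_def
    by (rule infsum_cong_neutral) (auto simp: delta_def)
  then show ?thesis by (simp add: delta_def)
qed

lemma distribution_of_monom:
  "distribution_of (vector_state e) T (monom 1 n) = (T ^^ n) (delta e) e"
proof -
  have "(\<Sum>i\<le>n. coeff (monom (1::complex) n) i * (T ^^ i) (delta e) e) =
      (\<Sum>i\<le>n. if i = n then (T ^^ i) (delta e) e else 0)"
    by (intro sum.cong) auto
  then show ?thesis
    by (simp add: distribution_of_def vector_state_eq poly_operator_def degree_monom_eq)
qed

definition linear_operator :: "'v operator \<Rightarrow> bool" where
  "linear_operator T \<longleftrightarrow>
     (\<forall>f g. T (\<lambda>x. f x + g x) = (\<lambda>x. T f x + T g x)) \<and>
     (\<forall>c f. T (\<lambda>x. c * f x) = (\<lambda>x. c * T f x))"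

lemma linear_operator_add:
  "linear_operator T \<Longrightarrow> T (\<lambda>x. f x + g x) = (\<lambda>x. T f x + T g x)"
  by (simp add: linear_operator_def)

lemma linear_operator_scale: "linear_operator T \<Longrightarrow> T (\<lambda>x. c * f x) = (\<lambda>x. c * T f x)"
  by (simp add: linear_operator_def)

lemma linear_operator_zero: "linear_operator T \<Longrightarrow> T (\<lambda>x. 0) = (\<lambda>x. 0)"
  using linear_operator_scale[of T 0 "\<lambda>x. 0"] by simp

lemma linear_operator_sum:
  assumes "linear_operator T"
  shows "T (\<lambda>x. \<Sum>i\<in>I. f i x) = (\<lambda>x. \<Sum>i\<in>I. T (f i) x)"
  by (induction I rule: infinite_finite_induct)
     (simp_all add: linear_operator_zero[OF assms]
        linear_operator_add[OF assms, of "f i" "\<lambda>x. \<Sum>j\<in>F. f j x" for i F])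

lemma linear_operator_compose:
  "linear_operator S \<Longrightarrow> linear_operator T \<Longrightarrow> linear_operator (S \<circ> T)"
  by (simp add: linear_operator_def)

lemma linear_operator_adjacency: "linear_operator (adjacency_operator G)"
  by (simp add: linear_operator_def adjacency_operator_def fun_eq_iff distrib_left sum.distrib
      sum_distrib_left mult.left_commute)

section \<open>Excursions from the root: taboo vectors and first returns\<close>

definition kill :: "'v \<Rightarrow> 'v operator" where
  "kill e f = f(e := 0)"

lemma kill_apply: "kill e f x = (if x = e then 0 else f x)"
  by (simp add: kill_def)

lemma kill_root [simp]: "kill e f e = 0"
  by (simp add: kill_def)

lemma kill_decomposition: "f = (\<lambda>x. f e * delta e x + kill e f x)"
  by (auto simp: kill_def delta_def)

lemma linear_operator_kill: "linear_operator (kill e)"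
  by (auto simp: linear_operator_def kill_def fun_eq_iff)

text \<open>For an adjacency operator, the value at \<open>x\<close> counts the walks of length
  \<open>k\<close> from the root to \<open>x\<close> that do not visit the root after time 0
  (compare taboo probabilities of Markov chains).\<close>

definition taboo_vector :: "'v \<Rightarrow> 'v operator \<Rightarrow> nat \<Rightarrow> 'v \<Rightarrow> complex" where
  "taboo_vector e T k = ((\<lambda>f. kill e (T f)) ^^ k) (delta e)"

lemma taboo_vector_0 [simp]: "taboo_vector e T 0 = delta e"
  by (simp add: taboo_vector_def)

lemma taboo_vector_Suc: "taboo_vector e T (Suc k) = kill e (T (taboo_vector e T k))"
  by (simp add: taboo_vector_def)

lemma taboo_vector_root: "k > 0 \<Longrightarrow> taboo_vector e T k e = 0"
  by (cases k) (simp_all add: taboo_vector_Suc)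

definition first_return :: "'v \<Rightarrow> 'v operator \<Rightarrow> nat \<Rightarrow> complex" where
  "first_return e T k = T (taboo_vector e T k) e"

lemma first_return_0: "first_return e T 0 = T (delta e) e"
  by (simp add: first_return_def)

text \<open>One more \<open>T\<close> splits the taboo vector into its root value, a first return
  from which the walk starts afresh at \<open>delta e\<close>, and the next taboo vector. A return
  with index \<open>k\<close> happens at time \<open>k + 1\<close> and leaves
  \<open>n - 1 - k\<close> steps.\<close>

lemma power_first_return_decomposition:
  assumes "linear_operator T"
  shows "(T ^^ n) (delta e) =
    (\<lambda>x. taboo_vector e T n x + (\<Sum>k<n. first_return e T k * (T ^^ (n - 1 - k)) (delta e) x))"
proof (induction n)
  case 0
  show ?case by simp
next
  case (Suc n)
  have split: "T (taboo_vector e T n) =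
      (\<lambda>x. first_return e T n * delta e x + taboo_vector e T (Suc n) x)"
    unfolding first_return_def taboo_vector_Suc by (rule kill_decomposition)
  have "(T ^^ Suc n) (delta e) = T ((T ^^ n) (delta e))" by simp
  also have "\<dots> = (\<lambda>x. T (taboo_vector e T n) x +
      (\<Sum>k<n. first_return e T k * T ((T ^^ (n - 1 - k)) (delta e)) x))"
    by (subst Suc)
       (simp only: linear_operator_add[OF assms] linear_operator_sum[OF assms]
          linear_operator_scale[OF assms])
  also have "\<dots> = (\<lambda>x. T (taboo_vector e T n) x +
      (\<Sum>k<n. first_return e T k * (T ^^ (n - k)) (delta e) x))"
  proof -
    have "T ((T ^^ (n - 1 - k)) (delta e)) = (T ^^ (n - k)) (delta e)" if "k < n" for k
    proof -
      have "n - k = Suc (n - 1 - k)" using that by simp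
      then show ?thesis by simp
    qed
    then show ?thesis by simp
  qed
  also have "\<dots> = (\<lambda>x. taboo_vector e T (Suc n) x +
      (\<Sum>k<Suc n. first_return e T k * (T ^^ (Suc n - 1 - k)) (delta e) x))"
    by (simp add: split add_ac)
  finally show ?case .
qed

text \<open>At the root the decomposition of \<open>T ^^ n\<close> becomes the renewal equation
  \<open>F * (1 + psi ?\<mu>) = psi ?\<mu>\<close>, where \<open>F\<close> collects the first return
  coefficients; as \<open>1 + psi ?\<mu>\<close> is nonzero, this identifies \<open>F\<close> with
  \<open>eta ?\<mu>\<close>.\<close>

lemma eta_coeff_first_return:
  assumes "linear_operator T"
  shows "eta_coeff (distribution_of (vector_state e) T) n =
    (if n = 0 then 0 else first_return e T (n - 1))"
proof -
  let ?\<mu> = "distribution_of (vector_state e) T"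
  define F where "F = Abs_fps (\<lambda>n. if n = 0 then 0 else first_return e T (n - 1))"
  define m where "m n = (T ^^ n) (delta e) e" for n
  have one_psi: "1 + psi ?\<mu> = Abs_fps m"
    by (simp add: fps_eq_iff psi_def distribution_of_monom m_def delta_def)
  have "fps_nth (F * (1 + psi ?\<mu>)) n = fps_nth (psi ?\<mu>) n" for n
  proof (cases n)
    case 0
    then show ?thesis by (simp add: F_def psi_def)
  next
    case (Suc k)
    have "fps_nth (F * (1 + psi ?\<mu>)) n = (\<Sum>i\<le>Suc k. fps_nth F i * m (Suc k - i))"
      by (simp add: one_psi fps_mult_nth Suc atLeast0AtMost)
    also have "\<dots> = (\<Sum>i\<le>k. first_return e T i * m (k - i))"
      by (subst sum.atMost_Suc_shift) (simp add: F_def)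
    \<comment> \<open>At positive times the taboo vector vanishes at the root, so only the
      convolution remains.\<close>
    also have "\<dots> = m (Suc k)"
      unfolding m_def
      by (subst power_first_return_decomposition[OF assms, of "Suc k"])
         (simp add: taboo_vector_root lessThan_Suc_atMost)
    finally show ?thesis by (simp add: psi_def distribution_of_monom m_def Suc)
  qed
  then have F: "F * (1 + psi ?\<mu>) = psi ?\<mu>" by (simp add: fps_eq_iff)
  have "fps_nth (1 + psi ?\<mu>) 0 \<noteq> 0" by (simp add: psi_def)
  then have "1 + psi ?\<mu> \<noteq> 0" by force
  then have "eta ?\<mu> = F" unfolding eta_def using F by (metis nonzero_mult_div_cancel_right)
  then show ?thesis by (simp add: eta_coeff_def F_def)
qed

text \<open>Only moments enter \<open>psi\<close>, so it suffices that \<pi> carries powers of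
  \<open>S\<close> to powers of \<open>T\<close> and respects the root. It is applied with \<pi> the
  restriction of functions to one factor of the product.\<close>

lemma psi_distribution_intertwined:
  assumes "\<And>f. \<pi> (S f) = T (\<pi> f)" "\<pi> (delta e) = delta e'" "\<And>f. \<pi> f e' = f e"
  shows "psi (distribution_of (vector_state e) S) = psi (distribution_of (vector_state e') T)"
proof -
  have "\<pi> ((S ^^ n) f) = (T ^^ n) (\<pi> f)" for n f
    by (induction n) (simp_all add: assms(1))
  then have "(S ^^ n) (delta e) e = (T ^^ n) (delta e') e'" for n
    using assms(2,3) by metis
  then show ?thesis by (simp only: psi_def distribution_of_monom)
qed

section \<open>Boolean convolution in terms of eta coefficients\<close>

lemma rho_boolean_mult_conv: "rho (boolean_mult_conv \<mu> \<nu>) = rho \<mu> * rho \<nu>"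
  unfolding boolean_mult_conv_def using theI'[OF boolean_mult_conv_ex1] by blast

lemma eta_coeff_0: "eta_coeff \<mu> 0 = 0"
  by (simp add: eta_coeff_def eta_rho)

lemma eta_coeff_Suc: "eta_coeff \<mu> (Suc n) = fps_nth (rho \<mu>) n"
  by (simp add: eta_coeff_def eta_rho)

text \<open>The shift by one in \<open>eta_rho\<close> turns the product of the \<open>rho\<close>
  series into this Cauchy product.\<close>

lemma eta_coeff_boolean_mult_conv:
  "eta_coeff (boolean_mult_conv \<mu> \<nu>) (Suc n) =
     (\<Sum>i\<le>n. eta_coeff \<mu> (Suc i) * eta_coeff \<nu> (Suc (n - i)))"
  by (simp add: eta_coeff_Suc rho_boolean_mult_conv fps_mult_nth atLeast0AtMost)

lemma eta_coeff_cong_psi: "psi \<mu> = psi \<nu> \<Longrightarrow> eta_coeff \<mu> n = eta_coeff \<nu> n"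
  by (simp add: eta_coeff_def eta_def)


section \<open>Pairs of operators glued at a root\<close>

fun other :: "color \<Rightarrow> color" where
  "other Color1 = Color2"
| "other Color2 = Color1"

lemma other_neq [simp]: "other c \<noteq> c" "c \<noteq> other c"
  by (cases c; simp)+

lemma other_other [simp]: "other (other c) = c"
  by (cases c) simp_all

lemma color_eq_other_iff: "c = other d \<longleftrightarrow> c \<noteq> d"
  by (cases c; cases d) simp_all

definition alternate :: "color \<Rightarrow> nat \<Rightarrow> color" where
  "alternate c i = (if even i then c else other c)"

lemma alternate_0 [simp]: "alternate c 0 = c"
  by (simp add: alternate_def)

lemma alternate_Suc: "alternate c (Suc i) = alternate (other c) i"
  by (simp add: alternate_def)

definition supported :: "'v set \<Rightarrow> ('v \<Rightarrow> complex) \<Rightarrow> bool" where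
  "supported W f \<longleftrightarrow> (\<forall>x. x \<notin> W \<longrightarrow> f x = 0)"

lemma supported_kill: "supported W f \<Longrightarrow> supported W (kill e f)"
  by (simp add: supported_def kill_apply)

text \<open>An abstract form of the star loop product: \<open>W c\<close> is the vertex set of the
  factor of color \<open>c\<close>, and \<open>R c\<close> the adjacency operator of color
  \<open>c\<close>. The last assumption is what the added loops achieve.\<close>

locale glued_operators =
  fixes e :: 'v and W :: "color \<Rightarrow> 'v set" and R :: "color \<Rightarrow> 'v operator"
  assumes root: "e \<in> W c"
    and linear: "linear_operator (R c)"
    and preserves: "supported (W c) f \<Longrightarrow> supported (W c) (R c f)"
    and fixes_other: "supported (W (other c)) f \<Longrightarrow> f e = 0 \<Longrightarrow> R c f = f"
begin

section \<open>Boolean independence of the operators \<open>R c - id\<close>\<close>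

definition acts_on :: "color \<Rightarrow> 'v operator \<Rightarrow> bool" where
  "acts_on c T \<longleftrightarrow> linear_operator T \<and>
     (\<forall>f. supported (W c) f \<longrightarrow> supported (W c) (T f)) \<and>
     (\<forall>f. supported (W (other c)) f \<longrightarrow> f e = 0 \<longrightarrow> T f = (\<lambda>x. 0))"

lemma supported_delta: "supported (W c) (delta e)"
  using root by (auto simp: supported_def delta_def)

lemma supported_taboo_vector: "supported (W c) (taboo_vector e (R c) k)"
  by (induction k) (auto simp: supported_delta taboo_vector_Suc intro: supported_kill preserves)

text \<open>\<open>acts_on\<close> is chosen so that \<open>R c - id\<close> has it and sums,
  multiples and products preserve it. Subtracting \<open>id\<close> turns fixed into annihilated for
  functions on the other side that vanish at the root; in a product the right factor already
  annihilates them.\<close>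

lemma acts_on_nonunital_algebra:
  assumes "T \<in> nonunital_algebra (R c - id)"
  shows "acts_on c T"
  using assms
proof induction
  case generator
  show ?case using linear[of c] preserves[of c] fixes_other[of c]
    by (auto simp: acts_on_def linear_operator_def supported_def fun_eq_iff algebra_simps)
next
  case (add S T)
  then show ?case
    by (auto simp: acts_on_def linear_operator_def supported_def fun_eq_iff algebra_simps)
next
  case (scale T k)
  then show ?case
    by (auto simp: acts_on_def linear_operator_def supported_def fun_eq_iff algebra_simps)
next
  case (mult S T)
  then have "linear_operator (S \<circ> T)"
    by (intro linear_operator_compose) (simp_all add: acts_on_def)
  moreover have "supported (W c) ((S \<circ> T) f)" if "supported (W c) f" for f
    using mult that by (simp add: acts_on_def)
  moreover have "(S \<circ> T) f = (\<lambda>x. 0)" if "supported (W (other c)) f" "f e = 0" for f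
    using mult that by (simp add: acts_on_def linear_operator_zero)
  ultimately show ?case unfolding acts_on_def by blast
qed

text \<open>The part of \<open>f\<close> away from the root is annihilated, so \<open>T\<close> sees
  only the scalar \<open>f e\<close>.\<close>

lemma acts_on_other_side:
  assumes "acts_on c T" "supported (W (other c)) f"
  shows "T f = (\<lambda>x. f e * T (delta e) x)"
proof -
  have lin: "linear_operator T" using assms(1) by (simp add: acts_on_def)
  have "T (kill e f) = (\<lambda>x. 0)"
    using assms supported_kill[OF assms(2), of e] by (simp add: acts_on_def)
  then show ?thesis
    by (subst kill_decomposition[of f e])
       (simp add: linear_operator_add[OF lin] linear_operator_scale[OF lin])
qed

text \<open>The factors act from the right. What the tail produces lives on the other side, so the
  next factor sees only its root value, which splits off as a scalar; the support claim is carried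
  along to make this available at each step.\<close>

lemma alternating_product:
  assumes "\<forall>i < length cs. acts_on (alternate c i) (cs ! i)"
  shows "supported (W c) (foldr (\<circ>) cs id (delta e)) \<and>
    foldr (\<circ>) cs id (delta e) e = prod_list (map (vector_state e) cs)"
  using assms
proof (induction cs arbitrary: c)
  case Nil
  then show ?case using supported_delta by (simp add: delta_def)
next
  case (Cons T ts)
  define g where "g = foldr (\<circ>) ts id (delta e)"
  have T: "acts_on c T" using Cons.prems by (metis alternate_0 length_greater_0_conv list.distinct(1) nth_Cons_0)
  have "\<forall>i < length ts. acts_on (alternate (other c) i) (ts ! i)"
    using Cons.prems by (auto simp: alternate_Suc)
  from Cons.IH[OF this] have g: "supported (W (other c)) g"
      "g e = prod_list (map (vector_state e) ts)" unfolding g_def by (rule conjunct1, rule conjunct2)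
  have Tg: "T g = (\<lambda>x. g e * T (delta e) x)" by (rule acts_on_other_side[OF T g(1)])
  have "supported (W c) (T (delta e))" using T supported_delta by (simp add: acts_on_def)
  then have supp: "supported (W c) (T g)" unfolding Tg by (simp add: supported_def)
  have "T g e = vector_state e T * prod_list (map (vector_state e) ts)"
    unfolding Tg g(2) vector_state_eq[of e T] by (rule mult.commute)
  moreover have "foldr (\<circ>) (T # ts) id (delta e) = T g" by (simp only: foldr.simps comp_apply g_def)
  ultimately show ?case using supp by (simp only: list.map prod_list.Cons simp_thms)
qed

lemma boolean_independent_minus_id:
  assumes "c \<noteq> d"
  shows "boolean_independent (vector_state e) (R c - id) (R d - id)"
  unfolding boolean_independent_def
proof (intro allI impI)
  fix cs :: "'v operator list"
  assume *: "cs \<noteq> [] \<and>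
     ((\<forall>i < length cs. cs ! i \<in> nonunital_algebra (if even i then R c - id else R d - id)) \<or>
      (\<forall>i < length cs. cs ! i \<in> nonunital_algebra (if even i then R d - id else R c - id)))"
  have d: "d = other c" using assms by (simp add: color_eq_other_iff)
  \<comment> \<open>The two orders of alternation differ only in the starting color
    \<open>b\<close>.\<close>
  from * have "\<exists>b. \<forall>i < length cs. acts_on (alternate b i) (cs ! i)"
  proof (elim conjE disjE)
    assume "\<forall>i < length cs. cs ! i \<in> nonunital_algebra (if even i then R c - id else R d - id)"
    then have "\<forall>i < length cs. acts_on (alternate c i) (cs ! i)"
      using acts_on_nonunital_algebra by (auto simp: alternate_def d split: if_splits)
    then show ?thesis by blast
  next
    assume "\<forall>i < length cs. cs ! i \<in> nonunital_algebra (if even i then R d - id else R c - id)"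
    then have "\<forall>i < length cs. acts_on (alternate d i) (cs ! i)"
      using acts_on_nonunital_algebra by (auto simp: alternate_def d split: if_splits)
    then show ?thesis by blast
  qed
  then show "vector_state e (foldr (\<circ>) cs id) = prod_list (map (vector_state e) cs)"
    using alternating_product by (auto simp: vector_state_eq)
qed

section \<open>First returns of the product of \<open>R (other c)\<close> and
  \<open>R c\<close>\<close>

lemma product_on_sum:
  assumes u: "supported (W c) u" and w: "supported (W (other c)) w" "w e = 0"
  shows "R (other c) (R c (\<lambda>x. u x + w x)) =
    (\<lambda>x. R c u e * R (other c) (delta e) x + kill e (R c u) x + R (other c) w x)"
proof -
  \<comment> \<open>Already on the other side, \<open>w\<close> is fixed by \<open>R c\<close>. The
    root value of \<open>R c u\<close> is separated because it is the only part of
    \<open>R c u\<close> that \<open>R (other c)\<close> moves.\<close>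
  have "R c (\<lambda>x. u x + w x) = (\<lambda>x. R c u x + w x)"
    by (simp add: linear_operator_add[OF linear] fixes_other[OF w])
  also have "\<dots> = (\<lambda>x. (R c u e * delta e x + kill e (R c u) x) + w x)"
    by (subst kill_decomposition[of "R c u" e]) simp
  finally have "R (other c) (R c (\<lambda>x. u x + w x)) = (\<lambda>x. (R c u e * R (other c) (delta e) x +
      R (other c) (kill e (R c u)) x) + R (other c) w x)"
    by (simp only: linear_operator_add[OF linear] linear_operator_scale[OF linear])
  moreover have "R (other c) (kill e (R c u)) = kill e (R c u)"
    by (rule fixes_other) (use preserves[OF u] supported_kill in auto)
  ultimately show ?thesis by simp
qed

text \<open>Summand \<open>j\<close> describes a passage between the factors: the first color
  returns in step \<open>j + 1\<close> of the product, the other color leaves the root in that same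
  step and has made \<open>k - j\<close> steps by time \<open>k\<close>. The root is removed only
  after a full step of the product, so the passage survives; afterwards \<open>R c\<close> leaves
  the vector unchanged.\<close>

lemma taboo_vector_product:
  "taboo_vector e (R (other c) \<circ> R c) k =
     (\<lambda>x. taboo_vector e (R c) k x +
       (\<Sum>j<k. first_return e (R c) j * taboo_vector e (R (other c)) (k - j) x))"
proof (induction k)
  case 0
  show ?case by simp
next
  case (Suc k)
  let ?r = "first_return e (R c)" and ?t = "taboo_vector e (R (other c))"
  define w where "w = (\<lambda>x. \<Sum>j<k. ?r j * ?t (k - j) x)"
  have w: "supported (W (other c)) w" "w e = 0"
    using supported_taboo_vector[of "other c"]
    by (auto simp: w_def supported_def taboo_vector_root)
  have tv: "taboo_vector e (R (other c) \<circ> R c) k = (\<lambda>x. taboo_vector e (R c) k x + w x)"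
    unfolding Suc w_def ..
  have "taboo_vector e (R (other c) \<circ> R c) (Suc k) =
      kill e (\<lambda>x. ?r k * R (other c) (delta e) x + kill e (R c (taboo_vector e (R c) k)) x +
        R (other c) w x)"
    unfolding taboo_vector_Suc tv comp_apply product_on_sum[OF supported_taboo_vector w]
      first_return_def ..
  also have "\<dots> = (\<lambda>x. taboo_vector e (R c) (Suc k) x + (?r k * ?t 1 x +
      (\<Sum>j<k. ?r j * ?t (Suc (k - j)) x)))"
    unfolding w_def linear_operator_sum[OF linear] linear_operator_scale[OF linear]
    by (auto simp: taboo_vector_Suc kill_apply)
  \<comment> \<open>The term \<open>?r k * ?t 1\<close> is the new summand
    \<open>j = k\<close>.\<close>
  also have "\<dots> = (\<lambda>x. taboo_vector e (R c) (Suc k) x + (\<Sum>j<Suc k. ?r j * ?t (Suc k - j) x))"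
    by (auto simp: Suc_diff_le intro!: sum.cong)
  finally show ?case .
qed

text \<open>One more step after \<open>taboo_vector_product\<close>, now evaluated at the root. The
  summand \<open>j = n\<close> comes from the vector still on the first side: it returns in color
  \<open>c\<close>, and the other color at once returns with index 0.\<close>

lemma first_return_product:
  "first_return e (R (other c) \<circ> R c) n =
     (\<Sum>j\<le>n. first_return e (R c) j * first_return e (R (other c)) (n - j))"
proof -
  let ?r = "first_return e (R c)" and ?t = "taboo_vector e (R (other c))"
  define w where "w = (\<lambda>x. \<Sum>j<n. ?r j * ?t (n - j) x)"
  have w: "supported (W (other c)) w" "w e = 0"
    using supported_taboo_vector[of "other c"]
    by (auto simp: w_def supported_def taboo_vector_root)
  have tv: "taboo_vector e (R (other c) \<circ> R c) n = (\<lambda>x. taboo_vector e (R c) n x + w x)"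
    unfolding taboo_vector_product w_def ..
  have "first_return e (R (other c) \<circ> R c) n = ?r n * R (other c) (delta e) e + R (other c) w e"
    unfolding first_return_def[of e "R (other c) \<circ> R c"] tv comp_apply
      product_on_sum[OF supported_taboo_vector w] by (simp add: first_return_def)
  also have "R (other c) w e = (\<Sum>j<n. ?r j * first_return e (R (other c)) (n - j))"
    by (simp add: w_def linear_operator_sum[OF linear] linear_operator_scale[OF linear]
        first_return_def)
  finally show ?thesis
    unfolding lessThan_Suc_atMost[symmetric] sum.lessThan_Suc
    by (simp only: first_return_0 add.commute diff_self_eq_0)
qed

text \<open>
  Between two visits to the root every second step is a loop, so \<open>i\<close> alternating steps amount to
  \<open>\<lceil>i/2\<rceil>\<close> steps of the first color.
\<close>

lemma alternating_taboo_steps: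
  assumes "x 0 = (\<lambda>v. s * delta e v)"
    and "\<And>i. Suc i < l \<Longrightarrow> x (Suc i) = kill e (R (alternate c i) (x i))"
  shows "i < l \<Longrightarrow> x i = (\<lambda>v. s * taboo_vector e (R c) (Suc i div 2) v)"
proof (induction i)
  case 0
  show ?case by (simp add: assms(1))
next
  case (Suc i)
  let ?u = "taboo_vector e (R c) (Suc i div 2)"
  have step: "x (Suc i) = (\<lambda>v. s * kill e (R (alternate c i) ?u) v)"
    using Suc assms(2)
    by (simp add: linear_operator_scale[OF linear] linear_operator_scale[OF linear_operator_kill])
  show ?case
  proof (cases "even i")
    case True
    then have "Suc (Suc i) div 2 = Suc (Suc i div 2)" by simp
    then show ?thesis using True step by (simp add: alternate_def taboo_vector_Suc)
  next
    case False
    \<comment> \<open>For odd \<open>i\<close> the index is positive, so the vector vanishes at the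
      root and the other color acts on it only through loops.\<close>
    then have half: "Suc (Suc i) div 2 = Suc i div 2" "Suc i div 2 > 0"
      by (auto elim: oddE)
    have zero: "?u e = 0" using half(2) by (rule taboo_vector_root)
    have "R (other c) ?u = ?u"
      by (rule fixes_other) (simp_all add: supported_taboo_vector zero)
    moreover have "kill e ?u = ?u" using zero by (auto simp: kill_def)
    ultimately show ?thesis using False step half(1) by (simp add: alternate_def)
  qed
qed

text \<open>Step \<open>l - 1\<close> has color \<open>c\<close> exactly when \<open>l\<close> is
  odd. For even \<open>l\<close> it has the other color, which fixes a vector vanishing at the root,
  so nothing returns. For \<open>l = 2 * m + 1\<close> there are \<open>m + 1\<close> steps of color
  \<open>c\<close>, that is, first return index \<open>m = l div 2\<close>.\<close>

lemma alternating_taboo_return: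
  assumes "x 0 = (\<lambda>v. s * delta e v)"
    and "\<And>i. Suc i < l \<Longrightarrow> x (Suc i) = kill e (R (alternate c i) (x i))"
    and "l > 0"
  shows "R (alternate c (l - 1)) (x (l - 1)) e =
    (if odd l then s * first_return e (R c) (l div 2) else 0)"
proof -
  let ?u = "taboo_vector e (R c) (l div 2)"
  have x: "x (l - 1) = (\<lambda>v. s * ?u v)"
    using alternating_taboo_steps[of x s l c "l - 1"] assms by simp
  show ?thesis
  proof (cases "odd l")
    case True
    then show ?thesis
      using x by (simp add: linear_operator_scale[OF linear, where f = ?u] alternate_def
          first_return_def)
  next
    case False
    then have zero: "?u e = 0" using assms(3) by (intro taboo_vector_root) (auto elim: evenE)
    have "R (other c) ?u = ?u"
      by (rule fixes_other) (simp_all add: supported_taboo_vector zero)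
    then show ?thesis
      using False assms(3) zero
      using x by (simp add: linear_operator_scale[OF linear, where f = ?u] alternate_def)
  qed
qed

end


section \<open>Counting walks\<close>

lemma color_subgraph_simps [simp]:
  "verts (color_subgraph G col c) = verts G"
  "edges (color_subgraph G col c) = {\<beta> \<in> edges G. col \<beta> = c}"
  "ends (color_subgraph G col c) = ends G"
  by (simp_all add: color_subgraph_def)

lemma color_subgraph_neighbours_finite:
  assumes "wf_multigraph G" "uniformly_locally_finite G"
  shows "finite (neighbours (color_subgraph G col c) x)"
proof (rule finite_subset[OF _ neighbours_finite[OF assms]])
  show "neighbours (color_subgraph G col c) x \<subseteq> neighbours G x"
    by (auto simp: neighbours_def)
qed

section \<open>Walks with prescribed colors and admissible vertices at each time\<close>

definition constrained_walks ::
    "('v, 'e) multigraph \<Rightarrow> ('e \<Rightarrow> color) \<Rightarrow> (nat \<Rightarrow> color) \<Rightarrow> (nat \<Rightarrow> 'v set) \<Rightarrow> nat \<Rightarrow> 'v \<Rightarrow>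
     ('v, 'e) walk set" where
  "constrained_walks G col c U n y =
     {w. is_walk G w \<and> walk_length w = n \<and> (\<forall>i<n. col (snd w ! i) = c i) \<and>
         (\<forall>i\<le>n. fst w ! i \<in> U i) \<and> last (fst w) = y}"

text \<open>The transfer matrix side of the count of \<open>constrained_walks\<close>. The start
  \<open>delta e\<close> corresponds to \<open>U 0 = {e}\<close>, by which the sets \<open>U\<close>
  also encode the initial vertex.\<close>

fun walk_vector :: "(color \<Rightarrow> 'v operator) \<Rightarrow> (nat \<Rightarrow> color) \<Rightarrow> (nat \<Rightarrow> 'v set) \<Rightarrow> 'v \<Rightarrow> nat \<Rightarrow>
    'v \<Rightarrow> complex" where
  "walk_vector R c U e 0 = delta e"
| "walk_vector R c U e (Suc n) =
     (\<lambda>y. if y \<in> U (Suc n) then R (c n) (walk_vector R c U e n) y else 0)"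

lemma walk_verts_length: "is_walk G w \<Longrightarrow> length (fst w) = Suc (walk_length w)"
  by (cases w) (simp add: is_walk_def walk_length_def)

lemma walk_last:
  assumes "is_walk G w"
  shows "last (fst w) = fst w ! walk_length w"
proof -
  have "fst w \<noteq> []" using walk_verts_length[OF assms] by auto
  then show ?thesis by (simp add: last_conv_nth walk_verts_length[OF assms])
qed

lemma is_walk_snoc:
  assumes "length vs = Suc (length es)"
  shows "is_walk G (vs @ [y], es @ [\<beta>]) \<longleftrightarrow>
    is_walk G (vs, es) \<and> y \<in> verts G \<and> \<beta> \<in> edges G \<and> ends G \<beta> = Upair (last vs) y"
proof -
  have ne: "vs \<noteq> []" using assms by auto
  have last: "last vs = vs ! length es" using assms by (simp add: last_conv_nth ne)
  have "(\<forall>i < Suc (length es). ends G ((es @ [\<beta>]) ! i) = Upair ((vs @ [y]) ! i) ((vs @ [y]) ! Suc i))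
    \<longleftrightarrow> (\<forall>i < length es. ends G (es ! i) = Upair (vs ! i) (vs ! Suc i)) \<and>
        ends G \<beta> = Upair (last vs) y"
    using assms by (simp add: All_less_Suc nth_append last conj_commute)
  then show ?thesis using assms unfolding is_walk_def by (simp add: conj_ac)
qed

text \<open>A walk is taken apart at its last edge, \<open>z\<close> being the vertex before. The
  ends of that edge are read from \<open>y\<close>, to match row \<open>y\<close> of the adjacency
  matrix.\<close>

lemma constrained_walks_Suc:
  assumes "wf_multigraph G" "y \<in> U (Suc n)"
  shows "bij_betw (\<lambda>(z, (vs, es), \<beta>). (vs @ [y], es @ [\<beta>]))
    (SIGMA z:neighbours (color_subgraph G col (c n)) y.
       constrained_walks G col c U n z \<times>
       {\<beta> \<in> edges (color_subgraph G col (c n)). ends G \<beta> = Upair y z})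
    (constrained_walks G col c U (Suc n) y)"
    (is "bij_betw ?f ?S ?T")
  unfolding bij_betw_def
proof (intro conjI equalityI subsetI)
  \<comment> \<open>The vertex \<open>z\<close> is recovered from the walk as
    \<open>last vs\<close>.\<close>
  show "inj_on ?f ?S"
    by (auto simp: inj_on_def constrained_walks_def)
next
  fix w assume "w \<in> ?f ` ?S"
  then obtain z vs es \<beta> where w: "w = (vs @ [y], es @ [\<beta>])"
    and vs: "(vs, es) \<in> constrained_walks G col c U n z"
    and \<beta>: "\<beta> \<in> edges G" "col \<beta> = c n" "ends G \<beta> = Upair y z"
    by auto
  have len: "length vs = Suc n" "length es = n" "last vs = z"
    using vs by (auto simp: constrained_walks_def is_walk_def walk_length_def)
  have "y \<in> verts G" using assms(1) \<beta> by (auto simp: wf_multigraph_def)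
  moreover have "is_walk G (vs, es)" using vs by (simp add: constrained_walks_def)
  moreover have "Upair y z = Upair z y" by simp
  ultimately have "is_walk G w" using w len \<beta> by (simp add: is_walk_snoc)
  then show "w \<in> ?T" using vs w len \<beta> assms(2)
    by (auto simp: constrained_walks_def walk_length_def nth_append less_Suc_eq le_Suc_eq)
next
  fix w assume w: "w \<in> ?T"
  obtain vs' es' where w': "w = (vs', es')" by (cases w)
  have len': "length vs' = Suc (Suc n)" "length es' = Suc n" "last vs' = y"
    using w by (auto simp: w' constrained_walks_def is_walk_def walk_length_def)
  obtain vs where vs: "vs' = vs @ [y]"
    using len' by (cases vs' rule: rev_cases) auto
  obtain es \<beta> where es: "es' = es @ [\<beta>]"
    using len' by (cases es' rule: rev_cases) auto
  have len: "length vs = Suc n" "length es = n" using len' vs es by auto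
  have walk: "is_walk G (vs @ [y], es @ [\<beta>])"
    using w by (simp add: w' vs es constrained_walks_def)
  have step: "is_walk G (vs, es)" "\<beta> \<in> edges G" "ends G \<beta> = Upair (last vs) y"
    using walk len by (auto simp: is_walk_snoc)
  have colors: "\<forall>i < Suc n. col ((es @ [\<beta>]) ! i) = c i"
    and sets: "\<forall>i \<le> Suc n. (vs @ [y]) ! i \<in> U i"
    using w by (simp_all add: w' vs es constrained_walks_def)
  have "col \<beta> = c n" using colors[rule_format, of n] len by (simp add: nth_append)
  moreover have "\<forall>i<n. col (es ! i) = c i"
    using colors len by (simp add: nth_append less_Suc_eq)
  moreover have "\<forall>i\<le>n. vs ! i \<in> U i"
    using sets len by (simp add: nth_append le_Suc_eq less_Suc_eq_le)
  moreover have "ends G \<beta> = Upair y (last vs)" using step(3) by simp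
  ultimately have "(last vs, (vs, es), \<beta>) \<in> ?S"
    using step len by (auto simp: constrained_walks_def walk_length_def neighbours_def)
  then show "w \<in> ?f ` ?S"
    by (rule rev_image_eqI) (simp add: w' vs es)
qed

text \<open>Transfer matrix method: by the bijection for the last step, the counts for all end
  vertices \<open>y\<close> together obey the recursion of \<open>walk_vector\<close>, the number of
  choices of the last edge being a matrix entry.\<close>

lemma card_constrained_walks:
  assumes G: "wf_multigraph G" "uniformly_locally_finite G" and e: "e \<in> verts G" "U 0 = {e}"
  shows "finite (constrained_walks G col c U n y) \<and>
    of_nat (card (constrained_walks G col c U n y)) =
      walk_vector (\<lambda>k. adjacency_operator (color_subgraph G col k)) c U e n y"
proof (induction n arbitrary: y)
  case 0
  \<comment> \<open>\<open>U 0 = {e}\<close> leaves only the walk without edges at the root.\<close>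
  have "constrained_walks G col c U 0 y = (if y = e then {([e], [])} else {})"
  proof (rule set_eqI)
    fix w :: "('a, 'b) walk"
    obtain vs es where w: "w = (vs, es)" by (cases w)
    have "w \<in> constrained_walks G col c U 0 y \<longleftrightarrow> es = [] \<and> vs = [e] \<and> y = e"
    proof (cases "es = [] \<and> (\<exists>v. vs = [v])")
      case True
      then obtain v where "es = []" "vs = [v]" by blast
      then show ?thesis using e by (auto simp: w constrained_walks_def is_walk_def walk_length_def)
    next
      case False
      then have "es \<noteq> [] \<or> length vs \<noteq> Suc (length es)" by (auto simp: length_Suc_conv)
      then have "w \<notin> constrained_walks G col c U 0 y"
        by (simp add: w constrained_walks_def is_walk_def walk_length_def)
      then show ?thesis using False by blast
    qed
    then show "w \<in> constrained_walks G col c U 0 y \<longleftrightarrow> w \<in> (if y = e then {([e], [])} else {})"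
      by (auto simp: w)
  qed
  then show ?case by (simp add: delta_def)
next
  case (Suc n)
  let ?H = "color_subgraph G col (c n)"
  let ?R = "\<lambda>k. adjacency_operator (color_subgraph G col k)"
  let ?B = "\<lambda>z. {\<beta> \<in> edges ?H. ends G \<beta> = Upair y z}"
  let ?W = "constrained_walks G col c U n"
  show ?case
  proof (cases "y \<in> U (Suc n)")
    case True
    note bij = constrained_walks_Suc[OF G(1), of y U n col c, OF True]
    have fin_nb: "finite (neighbours ?H y)" by (rule color_subgraph_neighbours_finite[OF G])
    have fin_B: "finite (?B z)" for z
      by (rule finite_subset[OF _ incident_edges_finite[OF G, of y]])
         (auto simp: incident_edges_def)
    have fin: "finite (?W z \<times> ?B z)" for z using Suc fin_B by blast
    have "card (constrained_walks G col c U (Suc n) y) =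
        (\<Sum>z\<in>neighbours ?H y. card (?W z \<times> ?B z))"
      unfolding bij_betw_same_card[OF bij, symmetric]
      using fin_nb fin by (intro card_SigmaI) auto
    also have "of_nat \<dots> = (\<Sum>z\<in>neighbours ?H y. complex_of_nat (edge_count ?H y z) *
        walk_vector ?R c U e n z)"
      by (simp add: card_cartesian_product Suc[THEN conjunct2] edge_count_def mult.commute)
    also have "\<dots> = walk_vector ?R c U e (Suc n) y"
      using True by (simp add: adjacency_operator_def)
    moreover have "finite (constrained_walks G col c U (Suc n) y)"
      unfolding bij_betw_finite[OF bij, symmetric]
      by (rule finite_SigmaI[OF fin_nb fin])
    ultimately show ?thesis by simp
  next
    case False
    have "fst w ! Suc n = y" if "w \<in> constrained_walks G col c U (Suc n) y" for w
      using that walk_last[of G w] by (simp add: constrained_walks_def)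
    moreover have "fst w ! Suc n \<in> U (Suc n)" if "w \<in> constrained_walks G col c U (Suc n) y" for w
      using that by (simp add: constrained_walks_def)
    ultimately have "constrained_walks G col c U (Suc n) y = {}"
      using False by blast
    then show ?thesis using False by simp
  qed
qed

text \<open>\<open>N\<close> is the length of a d-walk and \<open>j\<close> the time of its middle return.\<close>

definition d_constraint :: "'v \<Rightarrow> nat \<Rightarrow> nat \<Rightarrow> nat \<Rightarrow> 'v set" where
  "d_constraint e N j i = (if i \<in> {0, j, N} then {e} else - {e})"

section \<open>D-walks as constrained walks\<close>

lemma alternating_iff:
  assumes "snd w \<noteq> []"
  shows "is_alternating col w \<and> col (hd (snd w)) = c \<longleftrightarrow>
    (\<forall>i < walk_length w. col (snd w ! i) = alternate c i)"
proof
  assume *: "is_alternating col w \<and> col (hd (snd w)) = c"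
  have "i < walk_length w \<longrightarrow> col (snd w ! i) = alternate c i" for i
  proof (induction i)
    case 0
    show ?case using * assms by (simp add: hd_conv_nth)
  next
    case (Suc i)
    show ?case
    proof
      assume i: "Suc i < walk_length w"
      then have "col (snd w ! Suc i) \<noteq> alternate c i"
        using Suc * by (auto simp: is_alternating_def)
      \<comment> \<open>With two colors, differing from the previous color determines the
        next.\<close>
      then show "col (snd w ! Suc i) = alternate c (Suc i)"
        by (auto simp: alternate_def color_eq_other_iff split: if_splits)
    qed
  qed
  then show "\<forall>i < walk_length w. col (snd w ! i) = alternate c i" by blast
next
  assume *: "\<forall>i < walk_length w. col (snd w ! i) = alternate c i"
  then have "col (hd (snd w)) = c"
    using assms *[rule_format, of 0] by (simp add: hd_conv_nth walk_length_def)
  moreover have "is_alternating col w"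
    unfolding is_alternating_def using * by (auto simp: alternate_def)
  ultimately show "is_alternating col w \<and> col (hd (snd w)) = c" by blast
qed

text \<open>One equivalence over all times replaces the separate conditions on ends and interior, so
  that f-walks can be compared with the sets \<open>d_constraint\<close> time by time.\<close>

lemma is_f_walk_iff:
  "is_f_walk G v w \<longleftrightarrow> is_walk G w \<and> walk_length w \<ge> 1 \<and>
     (\<forall>i \<le> walk_length w. fst w ! i = v \<longleftrightarrow> i \<in> {0, walk_length w})"
proof (cases "is_walk G w")
  case True
  let ?n = "walk_length w"
  have "fst w \<noteq> []" using walk_verts_length[OF True] by auto
  then have ends: "hd (fst w) = fst w ! 0" "last (fst w) = fst w ! ?n"
    using walk_last[OF True] by (simp_all add: hd_conv_nth)
  have "fst w ! 0 = v \<and> fst w ! ?n = v \<and> (\<forall>i. 1 \<le> i \<and> i < ?n \<longrightarrow> fst w ! i \<noteq> v) \<longleftrightarrow>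
      (\<forall>i \<le> ?n. fst w ! i = v \<longleftrightarrow> i \<in> {0, ?n})"
    (is "?A \<longleftrightarrow> ?B")
  proof
    assume A: ?A
    show ?B
    proof (intro allI impI)
      fix i assume "i \<le> ?n"
      then consider "i = 0" | "i = ?n" | "1 \<le> i" "i < ?n" by linarith
      then show "fst w ! i = v \<longleftrightarrow> i \<in> {0, ?n}" using A by cases auto
    qed
  next
    assume B: ?B
    have "fst w ! i \<noteq> v" if "1 \<le> i" "i < ?n" for i
      using B[rule_format, of i] that by simp
    then show ?A using B[rule_format, of 0] B[rule_format, of ?n] by simp
  qed
  then show ?thesis using True unfolding is_f_walk_def is_walk_between_def ends by blast
qed (simp add: is_f_walk_def is_walk_between_def)

text \<open>Both vertex formulas include the junction time \<open>walk_length u\<close>, where they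
  agree because the walks meet there.\<close>

lemma is_walk_concat:
  assumes "is_walk G u" "is_walk G w" "last (fst u) = hd (fst w)"
  shows "is_walk G (walk_concat u w)"
    and "walk_length (walk_concat u w) = walk_length u + walk_length w"
    and "i \<le> walk_length u \<Longrightarrow> fst (walk_concat u w) ! i = fst u ! i"
    and "i \<ge> walk_length u \<Longrightarrow> i \<le> walk_length u + walk_length w \<Longrightarrow>
      fst (walk_concat u w) ! i = fst w ! (i - walk_length u)"
proof -
  obtain us ds ws es where uw: "u = (us, ds)" "w = (ws, es)" by (cases u, cases w)
  obtain z zs where ws: "ws = z # zs" and zs: "length zs = length es"
    using assms(2) by (auto simp: uw is_walk_def length_Suc_conv)
  have us: "length us = Suc (length ds)" using assms(1) by (simp add: uw is_walk_def)
  then have "us \<noteq> []" by auto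
  then have z: "us ! length ds = z"
    using assms(3) us by (simp add: uw ws last_conv_nth)
  have nth1: "(us @ zs) ! i = us ! i" if "i \<le> length ds" for i
    using that us by (simp add: nth_append)
  have nth2: "(us @ zs) ! i = ws ! (i - length ds)" if "i \<ge> length ds" for i
  proof (cases "i = length ds")
    case True
    then show ?thesis using nth1 z ws by simp
  next
    case False
    then have "i - length ds = Suc (i - Suc (length ds))" using that by simp
    then show ?thesis using us that False ws by (simp add: nth_append)
  qed
  have "ends G ((ds @ es) ! i) = Upair ((us @ zs) ! i) ((us @ zs) ! Suc i)"
    if "i < length ds + length es" for i
  proof (cases "i < length ds")
    case True
    then show ?thesis using assms(1) nth1 by (simp add: uw is_walk_def nth_append)
  next
    case False
    then have "i - length ds < length es" "Suc i - length ds = Suc (i - length ds)"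
      using that by auto
    then show ?thesis using assms(2) nth2[of i] nth2[of "Suc i"] False
      by (simp add: uw is_walk_def nth_append)
  qed
  then show "is_walk G (walk_concat u w)"
    using assms(1,2) us ws zs by (auto simp: uw is_walk_def walk_concat_def)
  show "walk_length (walk_concat u w) = walk_length u + walk_length w"
    by (simp add: walk_concat_def walk_length_def)
  show "fst (walk_concat u w) ! i = fst u ! i" if "i \<le> walk_length u"
    using nth1 that by (simp add: uw ws walk_concat_def walk_length_def)
  show "fst (walk_concat u w) ! i = fst w ! (i - walk_length u)" if "i \<ge> walk_length u"
    using nth2 that by (simp add: uw ws walk_concat_def walk_length_def)
qed

lemma is_walk_split:
  assumes "is_walk G w" "j \<le> walk_length w"
  obtains u1 u2 where "is_walk G u1" "is_walk G u2" "last (fst u1) = hd (fst u2)"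
    "w = walk_concat u1 u2" "walk_length u1 = j" "walk_length u2 = walk_length w - j"
proof -
  obtain vs es where w: "w = (vs, es)" by (cases w)
  have len: "length vs = Suc (length es)" and j: "j \<le> length es"
    using assms by (auto simp: w is_walk_def walk_length_def)
  \<comment> \<open>The vertex of index \<open>j\<close> belongs to both pieces, whence
    \<open>Suc j\<close> vertices but \<open>j\<close> edges in the first.\<close>
  let ?u1 = "(take (Suc j) vs, take j es)" and ?u2 = "(drop j vs, drop j es)"
  show thesis
  proof (rule that[of ?u1 ?u2])
    show "is_walk G ?u1" using assms len j
      by (auto simp: w is_walk_def dest: in_set_takeD)
    show "is_walk G ?u2" using assms len j
      by (auto simp: w is_walk_def dest: in_set_dropD)
    have "take (Suc j) vs = take j vs @ [vs ! j]" using len j by (simp add: take_Suc_conv_app_nth)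
    then show "last (fst ?u1) = hd (fst ?u2)" using len j by (simp add: hd_drop_conv_nth)
    show "w = walk_concat ?u1 ?u2"
      by (simp add: w walk_concat_def tl_drop drop_Suc[symmetric])
  qed (use j in \<open>simp_all add: w walk_length_def\<close>)
qed

text \<open>A concatenation of two f-walks visits \<open>v\<close> exactly at its ends and at one
  intermediate time \<open>j\<close>, the length of the first piece; cutting there gives the
  converse. The range of \<open>j\<close> expresses that both pieces have positive length.\<close>

lemma concat_of_f_walks_iff:
  "(\<exists>u1 u2. is_f_walk G v u1 \<and> is_f_walk G v u2 \<and> w = walk_concat u1 u2) \<longleftrightarrow>
   is_walk G w \<and> (\<exists>j\<in>{1..<walk_length w}.
     \<forall>i \<le> walk_length w. fst w ! i \<in> d_constraint v (walk_length w) j i)"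
  (is "?L \<longleftrightarrow> ?R")
proof
  assume ?L
  then obtain u1 u2 where u: "is_f_walk G v u1" "is_f_walk G v u2" "w = walk_concat u1 u2"
    by blast
  have walks: "is_walk G u1" "is_walk G u2" "last (fst u1) = hd (fst u2)"
    using u by (simp_all add: is_f_walk_def is_walk_between_def)
  note concat = is_walk_concat[OF walks, folded u(3)]
  have pos: "walk_length u1 \<ge> 1" "walk_length u2 \<ge> 1"
    using u by (simp_all add: is_f_walk_def)
  have "fst w ! i \<in> d_constraint v (walk_length w) (walk_length u1) i" if "i \<le> walk_length w" for i
  proof (cases "i \<le> walk_length u1")
    case True
    then show ?thesis using u(1) concat(2,3) pos
      by (auto simp: is_f_walk_iff d_constraint_def)
  next
    case False
    then have "i - walk_length u1 \<le> walk_length u2" using that concat(2) by simp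
    then show ?thesis using u(2) concat(2) concat(4)[of i] False that pos
      by (auto simp: is_f_walk_iff d_constraint_def)
  qed
  then show ?R using concat(1,2) pos by (intro conjI bexI[of _ "walk_length u1"]) auto
next
  assume ?R
  then obtain j where w: "is_walk G w" and j: "1 \<le> j" "j < walk_length w"
    and *: "\<And>i. i \<le> walk_length w \<Longrightarrow> fst w ! i \<in> d_constraint v (walk_length w) j i"
    by auto
  obtain u1 u2 where u: "is_walk G u1" "is_walk G u2" "last (fst u1) = hd (fst u2)"
    "w = walk_concat u1 u2" "walk_length u1 = j" "walk_length u2 = walk_length w - j"
    using is_walk_split[OF w] j by (metis less_imp_le)
  note concat = is_walk_concat[OF u(1-3), folded u(4)]
  have "fst u1 ! i = v \<longleftrightarrow> i \<in> {0, j}" if "i \<le> j" for i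
    using concat(3)[of i] *[of i] that j u(5) by (auto simp: d_constraint_def split: if_splits)
  then have "is_f_walk G v u1" using u j by (simp add: is_f_walk_iff)
  moreover have "fst u2 ! i = v \<longleftrightarrow> i \<in> {0, walk_length u2}" if "i \<le> walk_length u2" for i
  proof -
    have "j + i \<le> walk_length w" using that j u(6) by simp
    moreover have "j + i = walk_length w \<longleftrightarrow> i = walk_length u2" using j u(6) by auto
    ultimately show ?thesis
      using concat(4)[of "j + i"] *[of "j + i"] j u(5,6)
      by (auto simp: d_constraint_def split: if_splits)
  qed
  then have "is_f_walk G v u2" using u j by (simp add: is_f_walk_iff)
  ultimately show ?L using u(4) by blast
qed

text \<open>Sorts the d-walks by the time \<open>j\<close> of the middle return; that they end at
  \<open>v\<close> is the constraint at time \<open>N\<close>.\<close>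

lemma alternating_d_walks_eq:
  "alternating_d_walks G col v N =
     (\<Union>j\<in>{1..<N}. constrained_walks G col (alternate Color1) (d_constraint v N j) N v)"
proof (rule set_eqI)
  fix w :: "('a, 'b) walk"
  have last: "last (fst w) = v"
    if "is_walk G w" "fst w ! walk_length w \<in> d_constraint v (walk_length w) j (walk_length w)" for j
    using that walk_last[of G w] by (simp add: d_constraint_def)
  show "w \<in> alternating_d_walks G col v N \<longleftrightarrow>
      w \<in> (\<Union>j\<in>{1..<N}. constrained_walks G col (alternate Color1) (d_constraint v N j) N v)"
  proof (cases "snd w = []")
    case True
    then show ?thesis
      by (auto simp: alternating_d_walks_def is_alternating_d_walk_def constrained_walks_def
          walk_length_def)
  next
    case False
    then show ?thesis
      using alternating_iff[OF False, of col Color1] last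
      unfolding alternating_d_walks_def is_alternating_d_walk_def concat_of_f_walks_iff
        constrained_walks_def
      by auto
  qed
qed

text \<open>The root is removed at all times strictly between 0, \<open>j\<close> and
  \<open>N\<close>, so there are two excursions, each evaluated by
  \<open>alternating_taboo_return\<close>; the first hands over a multiple of
  \<open>delta e\<close>. The second begins at time \<open>j\<close>, hence with color
  \<open>alternate c j\<close>.\<close>

lemma (in glued_operators) walk_vector_return:
  assumes "0 < j" "j < N"
  shows "walk_vector R (alternate c) (d_constraint e N j) e N e =
    (if odd j then first_return e (R c) (j div 2) else 0) *
    (if odd (N - j) then first_return e (R (alternate c j)) ((N - j) div 2) else 0)"
proof -
  define x where "x = walk_vector R (alternate c) (d_constraint e N j) e"
  define s where "s = (if odd j then first_return e (R c) (j div 2) else 0)"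
  have x_kill: "x (Suc i) = kill e (R (alternate c i) (x i))"
    if "Suc i \<noteq> j" "Suc i \<noteq> N" for i
    using that by (auto simp: x_def d_constraint_def kill_apply)
  \<comment> \<open>At times \<open>j\<close> and \<open>N\<close> the constraint set is the root
    alone, so only the root value is kept.\<close>
  have x_root: "x (Suc i) = (\<lambda>v. R (alternate c i) (x i) e * delta e v)"
    if "Suc i = j \<or> Suc i = N" for i
    using that by (auto simp: x_def d_constraint_def delta_def)
  have "R (alternate c (j - 1)) (x (j - 1)) e = (if odd j then 1 * first_return e (R c) (j div 2) else 0)"
    using assms by (intro alternating_taboo_return x_kill) (simp_all add: x_def)
  then have xj: "x j = (\<lambda>v. s * delta e v)"
    using x_root[of "j - 1"] assms by (simp add: s_def)
  have alt: "alternate (alternate c j) i = alternate c (j + i)" for i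
    by (simp add: alternate_def)
  let ?l = "N - j"
  have "R (alternate (alternate c j) (?l - 1)) (x (j + (?l - 1))) e =
      (if odd ?l then s * first_return e (R (alternate c j)) (?l div 2) else 0)"
    using assms xj
    by (intro alternating_taboo_return[where x = "\<lambda>i. x (j + i)"])
       (simp_all add: alt x_kill)
  moreover have "j + (?l - 1) = N - 1" using assms by simp
  ultimately have "x N e = (if odd ?l then s * first_return e (R (alternate c j)) (?l div 2) else 0)"
    using x_root[of "N - 1"] assms by (simp add: alt delta_def)
  then show ?thesis by (simp add: x_def s_def)
qed

text \<open>Both excursions must have odd length. As the total is even, this means that
  \<open>j\<close> is odd, and then the second excursion starts with \<open>Color2\<close>;
  \<open>j = 2 * m + 1\<close> gives the indices \<open>m\<close> and
  \<open>n - 1 - m\<close>.\<close>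

lemma card_alternating_d_walks:
  assumes G: "wf_multigraph G" "uniformly_locally_finite G" "e \<in> verts G"
    and glued: "glued_operators e W (\<lambda>c. adjacency_operator (color_subgraph G col c))"
  defines "r \<equiv> \<lambda>c. first_return e (adjacency_operator (color_subgraph G col c))"
  shows "finite (alternating_d_walks G col e (2 * n)) \<and>
    of_nat (card (alternating_d_walks G col e (2 * n))) = (\<Sum>j<n. r Color1 j * r Color2 (n - 1 - j))"
proof -
  let ?C = "\<lambda>j. constrained_walks G col (alternate Color1) (d_constraint e (2 * n) j) (2 * n) e"
  define s where "s j = (if odd j then r Color1 (j div 2) * r Color2 ((2 * n - j) div 2) else 0)" for j
  have C: "finite (?C j) \<and> of_nat (card (?C j)) =
      walk_vector (\<lambda>k. adjacency_operator (color_subgraph G col k)) (alternate Color1)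
        (d_constraint e (2 * n) j) e (2 * n) e" for j
    by (rule card_constrained_walks[OF G]) (simp add: d_constraint_def)
  have card_C: "of_nat (card (?C j)) = s j" if "j \<in> {1..<2 * n}" for j
    unfolding C[THEN conjunct2] using that
    by (subst glued_operators.walk_vector_return[OF glued])
       (auto simp: s_def r_def alternate_def)
  \<comment> \<open>At time \<open>i\<close> one constraint demands the root and the other forbids
    it.\<close>
  have disjoint: "?C i \<inter> ?C j = {}" if "i \<in> {1..<2 * n}" "j \<in> {1..<2 * n}" "i \<noteq> j" for i j
  proof (rule equals0I)
    fix w assume "w \<in> ?C i \<inter> ?C j"
    then have "fst w ! i \<in> d_constraint e (2 * n) i i \<inter> d_constraint e (2 * n) j i"
      using that by (auto simp: constrained_walks_def)
    then show False using that by (auto simp: d_constraint_def)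
  qed
  have "of_nat (card (alternating_d_walks G col e (2 * n))) = (\<Sum>j\<in>{1..<2 * n}. s j)"
    unfolding alternating_d_walks_eq
    by (subst card_UN_disjoint) (use C disjoint card_C in auto)
  also have "\<dots> = (\<Sum>j\<in>(\<lambda>j. 2 * j + 1) ` {..<n}. s j)"
  proof (rule sum.mono_neutral_right)
    show "\<forall>j\<in>{1..<2 * n} - (\<lambda>j. 2 * j + 1) ` {..<n}. s j = 0"
      by (auto simp: s_def elim!: oddE)
  qed auto
  also have "\<dots> = (\<Sum>j<n. s (2 * j + 1))"
    by (subst sum.reindex) (auto simp: inj_on_def)
  also have "\<dots> = (\<Sum>j<n. r Color1 j * r Color2 (n - 1 - j))"
  proof (rule sum.cong)
    fix j assume "j \<in> {..<n}"
    then have "2 * n - (2 * j + 1) = 2 * (n - 1 - j) + 1" by auto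
    then show "s (2 * j + 1) = r Color1 j * r Color2 (n - 1 - j)" by (simp add: s_def)
  qed simp
  finally have "of_nat (card (alternating_d_walks G col e (2 * n))) =
    (\<Sum>j<n. r Color1 j * r Color2 (n - 1 - j))" .
  moreover have "finite (alternating_d_walks G col e (2 * n))"
    unfolding alternating_d_walks_eq using C by auto
  ultimately show ?thesis by blast
qed


section \<open>The star loop product\<close>

lemma map_uprod_eq_Upair_iff:
  "map_uprod f u = Upair x y \<longleftrightarrow> (\<exists>a b. u = Upair a b \<and> x = f a \<and> y = f b)"
proof -
  obtain a b where "u = Upair a b" by (cases u)
  then show ?thesis by auto
qed

text \<open>A row of the adjacency matrix depends only on the edges at its vertex, so edges are
  compared at \<open>h x\<close> only; elsewhere \<open>H\<close> may have further ones, such as the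
  added loops.\<close>

lemma adjacency_operator_embedding:
  assumes "inj h" "inj \<iota>"
    and "{\<beta> \<in> edges H. h x \<in> set_uprod (ends H \<beta>)} = \<iota> ` incident_edges G x"
    and "\<And>\<beta>. ends H (\<iota> \<beta>) = map_uprod h (ends G \<beta>)"
  shows "adjacency_operator H f (h x) = adjacency_operator G (\<lambda>y. f (h y)) x"
proof -
  have edges: "{\<beta> \<in> edges H. ends H \<beta> = Upair (h x) v} =
      \<iota> ` {\<beta> \<in> edges G. map_uprod h (ends G \<beta>) = Upair (h x) v}" for v
  proof -
    have "{\<beta> \<in> edges H. ends H \<beta> = Upair (h x) v} =
        {\<beta> \<in> edges H. h x \<in> set_uprod (ends H \<beta>)} \<inter> {\<beta>. ends H \<beta> = Upair (h x) v}"
      by auto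
    also have "\<dots> = \<iota> ` {\<beta> \<in> edges G. map_uprod h (ends G \<beta>) = Upair (h x) v}"
      unfolding assms(3)
      by (auto simp: assms(4) incident_edges_def map_uprod_eq_Upair_iff inj_eq[OF assms(1)])
    finally show ?thesis .
  qed
  have eq: "map_uprod h u = Upair (h x) (h y) \<longleftrightarrow> u = Upair x y" for u y
    by (auto simp: map_uprod_eq_Upair_iff inj_eq[OF assms(1)])
  have count: "edge_count H (h x) (h y) = edge_count G x y" for y
    unfolding edge_count_def edges eq
    using assms(2) by (intro card_image) (auto intro: inj_on_subset)
  have "v \<in> neighbours H (h x) \<longleftrightarrow> v \<in> h ` neighbours G x" for v
  proof -
    have "v \<in> neighbours H (h x) \<longleftrightarrow> {\<beta> \<in> edges H. ends H \<beta> = Upair (h x) v} \<noteq> {}"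
      by (auto simp: neighbours_def)
    also have "\<dots> \<longleftrightarrow> v \<in> h ` neighbours G x"
      unfolding edges
      by (auto simp: neighbours_def map_uprod_eq_Upair_iff inj_eq[OF assms(1)])
    finally show ?thesis .
  qed
  then have nb: "neighbours H (h x) = h ` neighbours G x" by blast
  show ?thesis
    unfolding adjacency_operator_def nb
    using assms(1) by (subst sum.reindex) (auto simp: count intro: inj_on_subset)
qed

lemma adjacency_operator_single_loop:
  assumes "{\<beta> \<in> edges H. v \<in> set_uprod (ends H \<beta>)} = {l}" "ends H l = Upair v v"
  shows "adjacency_operator H f v = f v"
proof -
  have edges: "{\<beta> \<in> edges H. ends H \<beta> = Upair v w} = (if w = v then {l} else {})" for w
  proof -
    have "{\<beta> \<in> edges H. ends H \<beta> = Upair v w} =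
        {\<beta> \<in> edges H. v \<in> set_uprod (ends H \<beta>)} \<inter> {\<beta>. ends H \<beta> = Upair v w}"
      by auto
    then show ?thesis unfolding assms(1) using assms(2) by auto
  qed
  have "w \<in> neighbours H v \<longleftrightarrow> {\<beta> \<in> edges H. ends H \<beta> = Upair v w} \<noteq> {}" for w
    by (auto simp: neighbours_def)
  then have "neighbours H v = {v}" unfolding edges by auto
  then show ?thesis by (simp add: adjacency_operator_def edge_count_def edges)
qed

lemma adjacency_operator_outside:
  assumes "wf_multigraph G" "x \<notin> verts G"
  shows "adjacency_operator G f x = 0"
proof -
  have "neighbours G x = {}"
    using assms by (force simp: neighbours_def wf_multigraph_def)
  then show ?thesis by (simp add: adjacency_operator_def)
qed

context
  fixes G1 :: "('a, 'c) multigraph" and e1 :: 'a and G2 :: "('b, 'd) multigraph" and e2 :: 'b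
  assumes G1: "rooted_graph G1 e1" and G2: "rooted_graph G2 e2"
begin

section \<open>The two colors of the star loop product\<close>

abbreviation colored_adjacency :: "color \<Rightarrow> ('a \<times> 'b) operator" where
  "colored_adjacency c \<equiv>
     adjacency_operator (color_subgraph (star_loop_product G1 e1 G2 e2) natural_coloring c)"

definition colored_verts :: "color \<Rightarrow> ('a \<times> 'b) set" where
  "colored_verts c = (case c of Color1 \<Rightarrow> (\<lambda>x. (x, e2)) ` verts G1
                              | Color2 \<Rightarrow> (\<lambda>y. (e1, y)) ` verts G2)"

lemma star_loop_product_edges:
  "{\<beta> \<in> edges (color_subgraph (star_loop_product G1 e1 G2 e2) natural_coloring Color1). P \<beta>} =
     (\<lambda>\<beta>. Inl (Inl \<beta>)) ` {\<beta> \<in> edges G1. P (Inl (Inl \<beta>))} \<union>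
     (\<lambda>y. Inr (Color1, (e1, y))) ` {y \<in> verts G2 - {e2}. P (Inr (Color1, (e1, y)))}"
  "{\<beta> \<in> edges (color_subgraph (star_loop_product G1 e1 G2 e2) natural_coloring Color2). P \<beta>} =
     (\<lambda>\<beta>. Inl (Inr \<beta>)) ` {\<beta> \<in> edges G2. P (Inl (Inr \<beta>))} \<union>
     (\<lambda>x. Inr (Color2, (x, e2))) ` {x \<in> verts G1 - {e1}. P (Inr (Color2, (x, e2)))}"
  by (auto simp: star_loop_product_def star_product_def natural_coloring_def star_coloring_def)

lemma star_loop_product_ends:
  "ends (star_loop_product G1 e1 G2 e2) (Inl (Inl \<beta>)) = map_uprod (\<lambda>x. (x, e2)) (ends G1 \<beta>)"
  "ends (star_loop_product G1 e1 G2 e2) (Inl (Inr \<gamma>)) = map_uprod (\<lambda>y. (e1, y)) (ends G2 \<gamma>)"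
  "ends (star_loop_product G1 e1 G2 e2) (Inr (c, v)) = Upair v v"
  by (simp_all add: star_loop_product_def star_product_def)

lemma set_map_uprod: "set_uprod (map_uprod h u) = h ` set_uprod u"
  by (cases u) auto

text \<open>No loop of color 1 is added on the first factor, the common root included, and none of
  color 2 on the second. So the edges of a color at a vertex of its own factor are those of the
  original graph.\<close>

lemma colored_adjacency_own:
  "colored_adjacency Color1 f (x, e2) = adjacency_operator G1 (\<lambda>y. f (y, e2)) x"
  "colored_adjacency Color2 f (e1, y) = adjacency_operator G2 (\<lambda>z. f (e1, z)) y"
proof -
  show "colored_adjacency Color1 f (x, e2) = adjacency_operator G1 (\<lambda>y. f (y, e2)) x"
    by (rule adjacency_operator_embedding[where h = "\<lambda>x. (x, e2)" and \<iota> = "\<lambda>\<beta>. Inl (Inl \<beta>)"])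
       (auto simp: inj_def star_loop_product_edges star_loop_product_ends set_map_uprod
          incident_edges_def simp del: color_subgraph_simps(2))
  show "colored_adjacency Color2 f (e1, y) = adjacency_operator G2 (\<lambda>z. f (e1, z)) y"
    by (rule adjacency_operator_embedding[where h = "\<lambda>y. (e1, y)" and \<iota> = "\<lambda>\<beta>. Inl (Inr \<beta>)"])
       (auto simp: inj_def star_loop_product_edges star_loop_product_ends set_map_uprod
          incident_edges_def simp del: color_subgraph_simps(2))
qed

text \<open>At a non-root vertex the added loop is the only edge of the opposite factor's color, and
  it contributes 1 to the diagonal.\<close>

lemma colored_adjacency_loop:
  "y \<in> verts G2 \<Longrightarrow> y \<noteq> e2 \<Longrightarrow> colored_adjacency Color1 f (e1, y) = f (e1, y)"
  "x \<in> verts G1 \<Longrightarrow> x \<noteq> e1 \<Longrightarrow> colored_adjacency Color2 f (x, e2) = f (x, e2)"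
proof -
  show "colored_adjacency Color1 f (e1, y) = f (e1, y)" if "y \<in> verts G2" "y \<noteq> e2"
    by (rule adjacency_operator_single_loop[where l = "Inr (Color1, (e1, y))"])
       (use that in \<open>auto simp: star_loop_product_edges star_loop_product_ends set_map_uprod
          simp del: color_subgraph_simps(2)\<close>)
  show "colored_adjacency Color2 f (x, e2) = f (x, e2)" if "x \<in> verts G1" "x \<noteq> e1"
    by (rule adjacency_operator_single_loop[where l = "Inr (Color2, (x, e2))"])
       (use that in \<open>auto simp: star_loop_product_edges star_loop_product_ends set_map_uprod
          simp del: color_subgraph_simps(2)\<close>)
qed

lemma star_loop_product_verts:
  "verts (star_loop_product G1 e1 G2 e2) = colored_verts Color1 \<union> colored_verts Color2"
  by (simp add: star_loop_product_def star_product_def colored_verts_def)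

lemma roots: "e1 \<in> verts G1" "e2 \<in> verts G2"
  using G1 G2 by (simp_all add: rooted_graph_def)

lemma colored_adjacency_outside:
  assumes "v \<notin> colored_verts Color1" "v \<notin> colored_verts Color2"
  shows "colored_adjacency c f v = 0"
proof (rule adjacency_operator_outside)
  have "wf_multigraph (star_loop_product G1 e1 G2 e2)"
    using G1 G2 by (auto simp: rooted_graph_def intro: star_loop_product_wf)
  then show "wf_multigraph (color_subgraph (star_loop_product G1 e1 G2 e2) natural_coloring c)"
    by (simp add: wf_multigraph_def)
qed (use assms star_loop_product_verts in auto)

lemma colored_adjacency_other:
  assumes "v \<in> colored_verts (other c)" "v \<noteq> (e1, e2)"
  shows "colored_adjacency c f v = f v"
  using assms colored_adjacency_loop by (cases c) (auto simp: colored_verts_def)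

text \<open>Edges of color \<open>c\<close> at a vertex of the factor of color \<open>c\<close> do
  not leave this factor.\<close>

lemma colored_adjacency_vanishing:
  assumes "\<And>w. w \<in> colored_verts c \<Longrightarrow> f w = 0" "v \<in> colored_verts c"
  shows "colored_adjacency c f v = 0"
proof -
  have "adjacency_operator G f x = 0"
    if "wf_multigraph G" "\<And>y. y \<in> verts G \<Longrightarrow> f y = 0"
    for G :: "('x, 'y) multigraph" and f x
  proof -
    have "neighbours G x \<subseteq> verts G" using that(1) by (force simp: neighbours_def wf_multigraph_def)
    then show ?thesis
      unfolding adjacency_operator_def using that(2) by (intro sum.neutral) auto
  qed
  note vanish = this
  have wf: "wf_multigraph G1" "wf_multigraph G2" using G1 G2 by (simp_all add: rooted_graph_def)
  show ?thesis
  proof (cases c)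
    case Color1
    obtain x where "v = (x, e2)" using assms(2) by (auto simp: Color1 colored_verts_def)
    moreover have "f (y, e2) = 0" if "y \<in> verts G1" for y
      using assms(1) that by (simp add: Color1 colored_verts_def)
    ultimately show ?thesis by (simp only: Color1 colored_adjacency_own vanish[OF wf(1)])
  next
    case Color2
    obtain y where "v = (e1, y)" using assms(2) by (auto simp: Color2 colored_verts_def)
    moreover have "f (e1, z) = 0" if "z \<in> verts G2" for z
      using assms(1) that by (simp add: Color2 colored_verts_def)
    ultimately show ?thesis by (simp only: Color2 colored_adjacency_own vanish[OF wf(2)])
  qed
qed

lemma colored_verts_cases:
  obtains "v \<in> colored_verts c" | "v \<in> colored_verts (other c)" "v \<noteq> (e1, e2)" "v \<notin> colored_verts c"
    | "v \<notin> colored_verts Color1" "v \<notin> colored_verts Color2"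
  using roots by (cases c) (auto simp: colored_verts_def)

lemma glued_colored_adjacency: "glued_operators (e1, e2) colored_verts colored_adjacency"
proof
  show "(e1, e2) \<in> colored_verts c" for c
    using roots by (cases c) (auto simp: colored_verts_def)
  show "linear_operator (colored_adjacency c)" for c
    by (rule linear_operator_adjacency)
  show "supported (colored_verts c) (colored_adjacency c f)" if "supported (colored_verts c) f" for c f
    unfolding supported_def
  proof (intro allI impI)
    fix v assume v: "v \<notin> colored_verts c"
    then have "f v = 0" using that unfolding supported_def by blast
    then show "colored_adjacency c f v = 0"
      using v by (cases v c rule: colored_verts_cases)
         (simp_all add: colored_adjacency_other colored_adjacency_outside)
  qed
  show "colored_adjacency c f = f"
    if f: "supported (colored_verts (other c)) f" "f (e1, e2) = 0" for c f
  proof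
    \<comment> \<open>The two vertex sets meet only in the root, where \<open>f\<close> vanishes by
      assumption.\<close>
    have zero: "f w = 0" if "w \<in> colored_verts c" for w
    proof (cases "w = (e1, e2)")
      case False
      then have "w \<notin> colored_verts (other c)"
        using that by (cases c) (auto simp: colored_verts_def)
      then show ?thesis using f(1) unfolding supported_def by blast
    qed (simp add: f(2))
    fix v
    show "colored_adjacency c f v = f v"
    \<comment> \<open>On the factor of color \<open>c\<close> both sides are zero, on the other one
      the loops act as the identity, and outside the product everything vanishes.\<close>
    proof (cases v c rule: colored_verts_cases)
      case 1
      then show ?thesis using zero by (simp add: colored_adjacency_vanishing)
    next
      case 2
      then show ?thesis by (simp add: colored_adjacency_other)
    next
      case 3
      then have "v \<notin> colored_verts (other c)" by (cases c) simp_all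
      then have "f v = 0" using f(1) unfolding supported_def by blast
      then show ?thesis using 3 by (simp add: colored_adjacency_outside)
    qed
  qed
qed

lemma eta_coeff_spectral_distribution:
  "eta_coeff (spectral_distribution G1 e1) n =
     eta_coeff (distribution_of (vector_state (e1, e2)) (colored_adjacency Color1)) n"
  "eta_coeff (spectral_distribution G2 e2) n =
     eta_coeff (distribution_of (vector_state (e1, e2)) (colored_adjacency Color2)) n"
  unfolding spectral_distribution_def
proof -
  show "eta_coeff (distribution_of (vector_state e1) (adjacency_operator G1)) n =
     eta_coeff (distribution_of (vector_state (e1, e2)) (colored_adjacency Color1)) n"
    by (intro eta_coeff_cong_psi psi_distribution_intertwined[symmetric, where \<pi> = "\<lambda>f x. f (x, e2)"])
       (auto simp: colored_adjacency_own delta_def)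
  show "eta_coeff (distribution_of (vector_state e2) (adjacency_operator G2)) n =
     eta_coeff (distribution_of (vector_state (e1, e2)) (colored_adjacency Color2)) n"
    by (intro eta_coeff_cong_psi psi_distribution_intertwined[symmetric, where \<pi> = "\<lambda>f y. f (e1, y)"])
       (auto simp: colored_adjacency_own delta_def)
qed

end

theorem proposition3p1:
  fixes G1 :: "('a, 'c) multigraph" and e1 :: 'a
    and G2 :: "('b, 'd) multigraph" and e2 :: 'b
    and G :: "('a \<times> 'b, ('c + 'd) + (color \<times> ('a \<times> 'b))) multigraph"
    and e :: "'a \<times> 'b"
    and \<mu>1 \<mu>2 :: "complex poly \<Rightarrow> complex"
    and R1 R2 Z :: "('a \<times> 'b) operator"
  assumes "rooted_graph G1 e1" and "rooted_graph G2 e2"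
    and "\<mu>1 = spectral_distribution G1 e1" and "\<mu>2 = spectral_distribution G2 e2"
    and "G = star_loop_product G1 e1 G2 e2" and "e = (e1, e2)"
    and "R1 = adjacency_operator (color_subgraph G natural_coloring Color1)"
    and "R2 = adjacency_operator (color_subgraph G natural_coloring Color2)"
    and "Z = R2 \<circ> R1"
  shows "(\<forall>n::nat.
            eta_coeff (distribution_of (vector_state e) Z) n
              = eta_coeff (boolean_mult_conv \<mu>1 \<mu>2) n \<and>
            finite (alternating_d_walks G natural_coloring e (2 * n)) \<and>
            eta_coeff (boolean_mult_conv \<mu>1 \<mu>2) n
              = of_nat (card (alternating_d_walks G natural_coloring e (2 * n)))) \<and>
         boolean_independent (vector_state e) (R1 - id) (R2 - id)"
proof -
  interpret glued_operators "(e1, e2)" "colored_verts G1 e1 G2 e2" "colored_adjacency G1 e1 G2 e2"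
    by (rule glued_colored_adjacency[OF assms(1,2)])
  \<comment> \<open>All three quantities are computed as the convolution of \<open>r Color1\<close>
    and \<open>r Color2\<close>.\<close>
  define r where "r c = first_return e (colored_adjacency G1 e1 G2 e2 c)" for c
  have R: "R1 = colored_adjacency G1 e1 G2 e2 Color1" "R2 = colored_adjacency G1 e1 G2 e2 Color2"
    using assms by simp_all
  have G: "wf_multigraph G" "uniformly_locally_finite G" "e \<in> verts G"
    using assms(1,2) star_loop_product_wf[of G1 G2 e1 e2]
      star_loop_product_uniformly_locally_finite[OF assms(1,2)]
    by (simp_all add: assms(5,6) rooted_graph_def star_loop_product_verts[OF assms(1,2)] root)
  have \<mu>: "eta_coeff \<mu>1 (Suc n) = r Color1 n" "eta_coeff \<mu>2 (Suc n) = r Color2 n" for n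
    unfolding assms(3,4) eta_coeff_spectral_distribution[OF assms(1,2)]
    by (simp_all add: eta_coeff_first_return linear_operator_adjacency r_def assms(6))
  \<comment> \<open>Here and for \<open>Z\<close> the coefficient of index 0 is zero, matching the
    empty sum.\<close>
  have conv: "eta_coeff (boolean_mult_conv \<mu>1 \<mu>2) n = (\<Sum>j<n. r Color1 j * r Color2 (n - 1 - j))" for n
    by (cases n) (simp_all add: eta_coeff_0 eta_coeff_boolean_mult_conv \<mu> lessThan_Suc_atMost)
  have "linear_operator Z"
    unfolding assms(9) R by (intro linear_operator_compose linear_operator_adjacency)
  \<comment> \<open>\<open>Z\<close> applies \<open>R1\<close> first, so this is the product formula
    with \<open>c = Color1\<close>.\<close>
  moreover have "first_return e Z n = (\<Sum>j\<le>n. r Color1 j * r Color2 (n - j))" for n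
    using first_return_product[of Color1 n] by (simp add: assms(6,9) R r_def)
  ultimately have "eta_coeff (distribution_of (vector_state e) Z) n =
      (\<Sum>j<n. r Color1 j * r Color2 (n - 1 - j))" for n
    by (cases n) (simp_all add: eta_coeff_first_return lessThan_Suc_atMost)
  moreover have "finite (alternating_d_walks G natural_coloring e (2 * n)) \<and>
      of_nat (card (alternating_d_walks G natural_coloring e (2 * n))) =
        (\<Sum>j<n. r Color1 j * r Color2 (n - 1 - j))" for n
    using card_alternating_d_walks[OF G, of "colored_verts G1 e1 G2 e2" natural_coloring n]
      glued_operators_axioms
    by (simp add: assms(5,6) r_def)
  moreover have "boolean_independent (vector_state e) (R1 - id) (R2 - id)"
    unfolding R assms(6) by (rule boolean_independent_minus_id) simp
  ultimately show ?thesis using conv by simp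
qed

end
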